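(* Let $\alpha,\beta\in(0,\infty]$ be fixed and let $n\to\infty$. Let $A_{n,\alpha,\beta}=A(S_{n,\alpha,\beta})$ be the number of symbols $\alpha$ on the diagonal of the random $\alpha/\beta$-staircase tableau $S_{n,\alpha,\beta}$. Then $A_{n,\alpha,\beta}$ is asymptotically normal: $$\frac{A_{n,\alpha,\beta}-\mathbb E A_{n,\alpha,\beta}}{(\operatorname{Var}A_{n,\alpha,\beta})^{1/2}}\overset{\mathrm d}{\longrightarrow}N(0,1),$$ or, more explicitly, $$\frac{A_{n,\alpha,\beta}-n/2}{\sqrt n}\overset{\mathrm d}{\longrightarrow}N(0,1/12).$$ Moreover, a corresponding local limit theorem holds: $$\mathbb P(A_{n,\alpha,\beta}=k)=\bigl(2\pi\operatorname{Var}A_{n,\alpha,\beta}\bigr)^{-1/2}\Bigl(e^{-\frac{(k-\mathbb E A_{n,\alpha,\beta})^2}{2\operatorname{Var}A_{n,\alpha,\beta}}}+o(1)\Bigr),$$ as $n\to\infty$, uniformly in $k\in\mathbb Z$, or, more explicitly, $$\mathbb P(A_{n,\alpha,\beta}=k)=\sqrt{\frac{6}{\pi n}}\Bigl(e^{-6(k-n/2)^2/n}+o(1)\Bigr),$$ as $n\to\infty$, uniformly in $k\in\mathbb Z$.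
   Context: An $\alpha/\beta$-staircase tableau of size $n\ge1$ is a filling of the Young diagram of shape $(n,n-1,\dots,2,1)$, whose boxes are $(i,j)$ (row $i$ from the top, column $j$ from the left) with $i,j\ge1$, $i+j\le n+1$, such that: each box is empty or contains one of the symbols $\alpha,\beta$; no diagonal box (box with $i+j=n+1$) is empty; all boxes in the same row and to the left of a $\beta$ are empty; all boxes in the same column and above an $\alpha$ are empty. Let $\bar{\mathcal S}_n$ be the set of these tableaux. For $S\in\bar{\mathcal S}_n$ let $N_\alpha(S),N_\beta(S)$ be the numbers of symbols $\alpha$ and $\beta$ in $S$, and $A(S)$ the number of symbols $\alpha$ in diagonal boxes. For parameter values $\alpha,\beta\in(0,\infty)$, $S_{n,\alpha,\beta}$ is the random element of $\bar{\mathcal S}_n$ with $\mathbb P(S_{n,\alpha,\beta}=S)=\alpha^{N_\alpha(S)}\beta^{N_\beta(S)}/Z_n(\alpha,\beta)$, where $Z_n(\alpha,\beta)=\sum_{S\in\bar{\mathcal S}_n}\alpha^{N_\alpha(S)}\beta^{N_\beta(S)}$. If exactly one of $\alpha,\beta$ is $\infty$, the distribution is the limit of this one as that parameter tends to $\infty$ with the other fixed; if $\alpha=\beta=\infty$, it is the limit as $\alpha=\beta\to\infty$. $N(\mu,\sigma^2)$ is the normal distribution with mean $\mu$ and variance $\sigma^2$, and $\overset{\mathrm d}{\longrightarrow}$ is convergence in distribution. *)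

theory Defs
  imports "HOL-Probability.Probability"
begin

datatype st_symbol = Sym_alpha | Sym_beta

text \<open>Boxes are pairs (row from the top, column from the left), both counted from 1. A filling is a
  partial map from boxes to symbols; \<open>None\<close> means that the box is empty.\<close>

type_synonym filling = "nat \<times> nat \<Rightarrow> st_symbol option"

definition staircase_boxes :: "nat \<Rightarrow> (nat \<times> nat) set" where
  "staircase_boxes n = {(i, j). 1 \<le> i \<and> 1 \<le> j \<and> i + j \<le> n + 1}"

definition staircase_tableaux :: "nat \<Rightarrow> filling set" where
  "staircase_tableaux n = {S.
     dom S \<subseteq> staircase_boxes n \<and>
     (\<forall>(i, j) \<in> staircase_boxes n. i + j = n + 1 \<longrightarrow> S (i, j) \<noteq> None) \<and>
     (\<forall>i j j'. S (i, j) = Some Sym_beta \<and> j' < j \<longrightarrow> S (i, j') = None) \<and>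
     (\<forall>i i' j. S (i, j) = Some Sym_alpha \<and> i' < i \<longrightarrow> S (i', j) = None)}"

definition num_symbols :: "st_symbol \<Rightarrow> filling \<Rightarrow> nat" where
  "num_symbols x S = card {b. S b = Some x}"

definition diag_alphas :: "nat \<Rightarrow> filling \<Rightarrow> nat" where
  "diag_alphas n S = card {(i, j). i + j = n + 1 \<and> S (i, j) = Some Sym_alpha}"

definition tableau_weight :: "real \<Rightarrow> real \<Rightarrow> filling \<Rightarrow> real" where
  "tableau_weight a b S = a ^ num_symbols Sym_alpha S * b ^ num_symbols Sym_beta S"

definition partition_fun :: "nat \<Rightarrow> real \<Rightarrow> real \<Rightarrow> real" where
  "partition_fun n a b = (\<Sum>S\<in>staircase_tableaux n. tableau_weight a b S)"

definition tableau_prob_fin :: "nat \<Rightarrow> real \<Rightarrow> real \<Rightarrow> filling \<Rightarrow> real" where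
  "tableau_prob_fin n a b S =
     (if S \<in> staircase_tableaux n then tableau_weight a b S / partition_fun n a b else 0)"

text \<open>The set of tableaux of size \<open>n\<close> is finite, so convergence of distributions on it is
  pointwise convergence of the point probabilities. The limits below exist for positive
  parameters; see \<open>tableau_prob_limit\<close>.\<close>

definition tableau_prob :: "nat \<Rightarrow> ennreal \<Rightarrow> ennreal \<Rightarrow> filling \<Rightarrow> real" where
  "tableau_prob n \<alpha> \<beta> S =
     (if \<alpha> \<noteq> \<infinity> \<and> \<beta> \<noteq> \<infinity> then tableau_prob_fin n (enn2real \<alpha>) (enn2real \<beta>) S
      else if \<beta> \<noteq> \<infinity> then Lim at_top (\<lambda>t. tableau_prob_fin n t (enn2real \<beta>) S)
      else if \<alpha> \<noteq> \<infinity> then Lim at_top (\<lambda>t. tableau_prob_fin n (enn2real \<alpha>) t S)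
      else Lim at_top (\<lambda>t. tableau_prob_fin n t t S))"

text \<open>The law of the random tableau. The side conditions of \<open>embed_pmf\<close> hold for positive
  parameters; see \<open>pmf_random_tableau\<close>.\<close>

definition random_tableau :: "nat \<Rightarrow> ennreal \<Rightarrow> ennreal \<Rightarrow> filling pmf" where
  "random_tableau n \<alpha> \<beta> = embed_pmf (tableau_prob n \<alpha> \<beta>)"

definition mean_A :: "nat \<Rightarrow> ennreal \<Rightarrow> ennreal \<Rightarrow> real" where
  "mean_A n \<alpha> \<beta> =
     measure_pmf.expectation (random_tableau n \<alpha> \<beta>) (\<lambda>S. real (diag_alphas n S))"

definition var_A :: "nat \<Rightarrow> ennreal \<Rightarrow> ennreal \<Rightarrow> real" where
  "var_A n \<alpha> \<beta> =
     measure_pmf.variance (random_tableau n \<alpha> \<beta>) (\<lambda>S. real (diag_alphas n S))"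

definition prob_A :: "nat \<Rightarrow> ennreal \<Rightarrow> ennreal \<Rightarrow> int \<Rightarrow> real" where
  "prob_A n \<alpha> \<beta> k =
     measure_pmf.prob (random_tableau n \<alpha> \<beta>) {S. int (diag_alphas n S) = k}"


subsection \<open>Well-definedness of the random tableau\<close>

lemma finite_staircase_boxes: "finite (staircase_boxes n)"
  by (rule finite_subset[of _ "{..n+1} \<times> {..n+1}"]) (auto simp: staircase_boxes_def)

lemma finite_staircase_tableaux: "finite (staircase_tableaux n)"
proof (rule finite_subset)
  have u: "(UNIV :: st_symbol set) = {Sym_alpha, Sym_beta}"
    using st_symbol.exhaust by auto
  have "finite (UNIV :: st_symbol set)"
    unfolding u by simp
  then have "finite (UNIV :: st_symbol option set)"
    by (simp add: UNIV_option_conv)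
  then show "finite {S :: filling. \<forall>x. (x \<in> staircase_boxes n \<longrightarrow> S x \<in> UNIV) \<and>
                                     (x \<notin> staircase_boxes n \<longrightarrow> S x = None)}"
    by (intro finite_set_of_finite_funs finite_staircase_boxes)
  show "staircase_tableaux n \<subseteq> {S :: filling. \<forall>x. (x \<in> staircase_boxes n \<longrightarrow> S x \<in> UNIV) \<and>
                                     (x \<notin> staircase_boxes n \<longrightarrow> S x = None)}"
    unfolding staircase_tableaux_def dom_def by blast
qed

lemma staircase_tableaux_nonempty: "staircase_tableaux n \<noteq> {}"
proof -
  have "(\<lambda>(i, j). if 1 \<le> i \<and> 1 \<le> j \<and> i + j = n + 1 then Some Sym_alpha else None)
          \<in> staircase_tableaux n"
    unfolding staircase_tableaux_def staircase_boxes_def dom_def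
    by simp (auto split: if_splits)
  then show ?thesis by blast
qed

lemma tableau_weight_pos: "a > 0 \<Longrightarrow> b > 0 \<Longrightarrow> tableau_weight a b S > 0"
  by (simp add: tableau_weight_def)

lemma partition_fun_pos: "a > 0 \<Longrightarrow> b > 0 \<Longrightarrow> partition_fun n a b > 0"
  unfolding partition_fun_def
  by (intro sum_pos finite_staircase_tableaux staircase_tableaux_nonempty tableau_weight_pos)

lemma tableau_prob_fin_nonneg: "a > 0 \<Longrightarrow> b > 0 \<Longrightarrow> tableau_prob_fin n a b S \<ge> 0"
  using tableau_weight_pos[of a b S] partition_fun_pos[of a b n] by (simp add: tableau_prob_fin_def)

lemma sum_tableau_prob_fin:
  assumes "a > 0" "b > 0"
  shows "(\<Sum>S\<in>staircase_tableaux n. tableau_prob_fin n a b S) = 1"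
proof -
  have "(\<Sum>S\<in>staircase_tableaux n. tableau_prob_fin n a b S)
        = (\<Sum>S\<in>staircase_tableaux n. tableau_weight a b S) / partition_fun n a b"
    by (simp add: tableau_prob_fin_def sum_divide_distrib)
  also have "\<dots> = 1"
    using partition_fun_pos[OF assms, of n] by (simp add: partition_fun_def)
  finally show ?thesis .
qed

lemma tendsto_power_ratio:
  fixes k m :: nat
  assumes "k \<le> m"
  shows "((\<lambda>t::real. t ^ k / t ^ m) \<longlongrightarrow> (if k = m then 1 else 0)) at_top"
proof -
  have "((\<lambda>t::real. inverse t ^ (m - k)) \<longlongrightarrow> 0 ^ (m - k)) at_top"
    by (intro tendsto_intros tendsto_inverse_0_at_top filterlim_ident)
  moreover have "0 ^ (m - k) = (if k = m then 1 else 0 :: real)"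
    using assms by auto
  moreover have "\<forall>\<^sub>F t::real in at_top. inverse t ^ (m - k) = t ^ k / t ^ m"
    using eventually_gt_at_top[of 0]
  proof eventually_elim
    case (elim t)
    have "t ^ m = t ^ k * t ^ (m - k)"
      using assms by (simp flip: power_add)
    then show ?case using elim by (simp add: field_simps)
  qed
  ultimately show ?thesis
    by (simp add: tendsto_cong)
qed

lemma weight_ratio_convergent:
  fixes c :: "'a \<Rightarrow> real" and N :: "'a \<Rightarrow> nat"
  assumes fin: "finite T" and S: "S \<in> T" and pos: "\<And>x. x \<in> T \<Longrightarrow> c x > 0"
  shows "\<exists>L. ((\<lambda>t. c S * t ^ N S / (\<Sum>x\<in>T. c x * t ^ N x)) \<longlongrightarrow> L) at_top"
proof -
  define m where "m = Max (N ` T)"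
  have le: "N x \<le> m" if "x \<in> T" for x
    using that fin by (simp add: m_def)
  have "m \<in> N ` T" unfolding m_def using fin S by (intro Max_in) auto
  then obtain y where y: "y \<in> T" "N y = m" by auto
  define D where "D = (\<Sum>x\<in>T. c x * (if N x = m then 1 else 0))"
  have "c y * (if N y = m then 1 else 0) \<le> D"
    unfolding D_def using fin y pos by (intro member_le_sum) (auto intro: less_imp_le)
  then have D: "D \<noteq> 0" using y pos[of y] by auto
  have "((\<lambda>t. c S * (t ^ N S / t ^ m) / (\<Sum>x\<in>T. c x * (t ^ N x / t ^ m)))
         \<longlongrightarrow> c S * (if N S = m then 1 else 0) / D) at_top"
    using D unfolding D_def
    by (intro tendsto_divide tendsto_sum tendsto_mult_left tendsto_power_ratio le S) auto
  moreover have "\<forall>\<^sub>F t::real in at_top. c S * (t ^ N S / t ^ m) / (\<Sum>x\<in>T. c x * (t ^ N x / t ^ m))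
         = c S * t ^ N S / (\<Sum>x\<in>T. c x * t ^ N x)"
    using eventually_gt_at_top[of 0]
  proof eventually_elim
    case (elim t)
    have "(\<Sum>x\<in>T. c x * (t ^ N x / t ^ m)) = (\<Sum>x\<in>T. c x * t ^ N x) / t ^ m"
      by (simp add: sum_divide_distrib)
    then show ?case using elim by simp
  qed
  ultimately show ?thesis
    by (blast intro: Lim_transform_eventually)
qed

lemma tableau_prob_fin_convergent:
  assumes "a > 0"
  shows "\<exists>L. ((\<lambda>t. tableau_prob_fin n t a S) \<longlongrightarrow> L) at_top"
    and "\<exists>L. ((\<lambda>t. tableau_prob_fin n a t S) \<longlongrightarrow> L) at_top"
    and "\<exists>L. ((\<lambda>t. tableau_prob_fin n t t S) \<longlongrightarrow> L) at_top"
proof -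
  note conv = weight_ratio_convergent[OF finite_staircase_tableaux, of S n]
  consider "S \<notin> staircase_tableaux n" | "S \<in> staircase_tableaux n" by blast
  then have *: "(\<exists>L. ((\<lambda>t. tableau_prob_fin n t a S) \<longlongrightarrow> L) at_top) \<and>
     (\<exists>L. ((\<lambda>t. tableau_prob_fin n a t S) \<longlongrightarrow> L) at_top) \<and>
     (\<exists>L. ((\<lambda>t. tableau_prob_fin n t t S) \<longlongrightarrow> L) at_top)"
  proof cases
    case 1
    then show ?thesis by (auto simp: tableau_prob_fin_def)
  next
    case 2
    note simps = tableau_prob_fin_def tableau_weight_def partition_fun_def
    have "\<exists>L. ((\<lambda>t. tableau_prob_fin n t a S) \<longlongrightarrow> L) at_top"
      using conv[OF 2, of "\<lambda>x. a ^ num_symbols Sym_beta x" "num_symbols Sym_alpha"] assms 2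
      by (simp add: simps mult.commute)
    moreover have "\<exists>L. ((\<lambda>t. tableau_prob_fin n a t S) \<longlongrightarrow> L) at_top"
      using conv[OF 2, of "\<lambda>x. a ^ num_symbols Sym_alpha x" "num_symbols Sym_beta"] assms 2
      by (simp add: simps)
    moreover have "\<exists>L. ((\<lambda>t. tableau_prob_fin n t t S) \<longlongrightarrow> L) at_top"
      using conv[OF 2, of "\<lambda>_. 1" "\<lambda>x. num_symbols Sym_alpha x + num_symbols Sym_beta x"] 2
      by (simp add: simps power_add)
    ultimately show ?thesis by blast
  qed
  from * show "\<exists>L. ((\<lambda>t. tableau_prob_fin n t a S) \<longlongrightarrow> L) at_top"
    and "\<exists>L. ((\<lambda>t. tableau_prob_fin n a t S) \<longlongrightarrow> L) at_top"
    and "\<exists>L. ((\<lambda>t. tableau_prob_fin n t t S) \<longlongrightarrow> L) at_top"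
    by blast+
qed

lemma tendsto_Lim_at_top:
  fixes f :: "real \<Rightarrow> real"
  assumes "\<exists>L. (f \<longlongrightarrow> L) at_top"
  shows "(f \<longlongrightarrow> Lim at_top f) at_top"
proof -
  obtain L where L: "(f \<longlongrightarrow> L) at_top" using assms by blast
  then have "Lim at_top f = L" by (intro tendsto_Lim) simp_all
  with L show ?thesis by simp
qed

lemma tableau_prob_limit:
  assumes "\<alpha> > 0" "\<beta> > 0"
  shows "((\<lambda>t. tableau_prob_fin n (if \<alpha> = \<infinity> then t else enn2real \<alpha>)
                 (if \<beta> = \<infinity> then t else enn2real \<beta>) S) \<longlongrightarrow> tableau_prob n \<alpha> \<beta> S) at_top"
proof -
  have pos: "enn2real x > 0" if "x > 0" "x \<noteq> \<infinity>" for x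
    using that by (simp add: enn2real_positive_iff top.not_eq_extremum)
  show ?thesis
    using tendsto_Lim_at_top[OF tableau_prob_fin_convergent(1)[OF pos[of \<beta>]], of n S]
      tendsto_Lim_at_top[OF tableau_prob_fin_convergent(2)[OF pos[of \<alpha>]], of n S]
      tendsto_Lim_at_top[OF tableau_prob_fin_convergent(3)[of 1], of n S] assms
    by (cases "\<alpha> = \<infinity>"; cases "\<beta> = \<infinity>") (simp_all add: tableau_prob_def)
qed

lemma pmf_random_tableau:
  assumes "\<alpha> > 0" "\<beta> > 0"
  shows "pmf (random_tableau n \<alpha> \<beta>) S = tableau_prob n \<alpha> \<beta> S"
proof -
  have pos: "enn2real x > 0" if "x > 0" "x \<noteq> \<infinity>" for x
    using that by (simp add: enn2real_positive_iff top.not_eq_extremum)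
  define f where "f t = tableau_prob_fin n (if \<alpha> = \<infinity> then t else enn2real \<alpha>)
                          (if \<beta> = \<infinity> then t else enn2real \<beta>)" for t
  have lim: "((\<lambda>t. f t S) \<longlongrightarrow> tableau_prob n \<alpha> \<beta> S) at_top" for S
    unfolding f_def by (rule tableau_prob_limit[OF assms])
  have nonneg: "tableau_prob n \<alpha> \<beta> S \<ge> 0" for S
    using lim
  proof (rule tendsto_lowerbound)
    show "\<forall>\<^sub>F t in at_top. 0 \<le> f t S"
      using eventually_gt_at_top[of 0] unfolding f_def
      by eventually_elim (intro tableau_prob_fin_nonneg, use pos assms in auto)
  qed simp
  have "((\<lambda>t. \<Sum>S\<in>staircase_tableaux n. f t S)
          \<longlongrightarrow> (\<Sum>S\<in>staircase_tableaux n. tableau_prob n \<alpha> \<beta> S)) at_top"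
    by (intro tendsto_sum lim)
  moreover have "((\<lambda>t. \<Sum>S\<in>staircase_tableaux n. f t S) \<longlongrightarrow> 1) at_top"
  proof (rule tendsto_eventually)
    show "\<forall>\<^sub>F t in at_top. (\<Sum>S\<in>staircase_tableaux n. f t S) = 1"
      using eventually_gt_at_top[of 0] unfolding f_def
      by eventually_elim (intro sum_tableau_prob_fin, use pos assms in auto)
  qed
  ultimately have sum1: "(\<Sum>S\<in>staircase_tableaux n. tableau_prob n \<alpha> \<beta> S) = 1"
    using tendsto_unique[OF trivial_limit_at_top_linorder] by blast
  have zero: "tableau_prob n \<alpha> \<beta> S = 0" if "S \<notin> staircase_tableaux n" for S
    using tendsto_unique[OF trivial_limit_at_top_linorder lim[of S], of 0] that
    by (simp add: f_def tableau_prob_fin_def)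
  have "(\<integral>\<^sup>+ S. ennreal (tableau_prob n \<alpha> \<beta> S) \<partial>count_space UNIV)
        = (\<Sum>S\<in>staircase_tableaux n. ennreal (tableau_prob n \<alpha> \<beta> S))"
    by (intro nn_integral_count_space' finite_staircase_tableaux) (auto simp: zero)
  also have "\<dots> = 1"
    using sum1 nonneg by simp
  finally show ?thesis
    unfolding random_tableau_def by (intro pmf_embed_pmf nonneg)
qed

end

theory Submission
  imports Defs "HOL-Computational_Algebra.Fundamental_Theorem_Algebra" "HOL-Real_Asymp.Real_Asymp"
begin

text \<open>Write \<open>a = 1 / \<alpha>\<close> and \<open>b = 1 / \<beta>\<close>. The number of diagonal symbols \<open>\<alpha>\<close> turns out to be distributed
  as a sum of independent Bernoulli variables whose variance grows like \<open>n / 12\<close>, and all the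
  limit statements are instances of the central and local limit theorems for such sums.

  The combinatorial input is a recursion for the generating polynomial of the tableaux. Removing
  the first column of a tableau of size \<open>n + 1\<close> leaves a tableau of size \<open>n\<close>, and the columns that
  can be put back depend only on the rows without \<open>\<beta>\<close>. Marking these rows by a variable \<open>u\<close> gives
  (\<open>tableau_poly_Suc\<close>)
  \<open>G\<^sub>n\<^sub>+\<^sub>1(u) = \<alpha>u (x - 1) G\<^sub>n(u) + (\<beta> + \<alpha>u) G\<^sub>n(u + \<beta>)\<close>.
  Replacing \<open>u\<close> by \<open>u + \<beta>\<close> amounts to replacing \<open>b u\<close> by \<open>b u + 1\<close>, and the generalised Eulerian
  polynomials, defined by \<open>P\<^sub>n\<^sub>+\<^sub>1 = (a + (n + b) x) P\<^sub>n + x (1 - x) P\<^sub>n'\<close>, satisfy the same recursion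
  thanks to an identity between the parameters \<open>b\<close> and \<open>b + 1\<close> (\<open>eulerian_poly_shift\<close>). Hence \<open>P\<^sub>n\<close>
  is, up to normalisation, the probability generating function of the diagonal count
  (\<open>tableau_prob_fin_poly\<close>). Its coefficients depend continuously on the parameters, so infinite
  parameters are covered by \<open>a = 0\<close> or \<open>b = 0\<close> (\<open>tableau_prob_poly\<close>).

  The analytic input is real-rootedness (\<open>diag_poly_bernoulli_prod\<close>): the differential recursion
  preserves the property of being a product of factors \<open>1 - q + q x\<close> with \<open>0 \<le> q \<le> 1\<close>. Taking
  logarithmic derivatives, the recursion multiplies such a product by a sum of terms whose
  imaginary parts at a non-real point never have opposite signs. Evaluating the recursion and its
  derivatives at \<open>1\<close> gives the exact mean and variance, hence \<open>n / 2 + o(\<surd>n)\<close> and \<open>n / 12 + o(n)\<close>.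

  For a product of Bernoulli factors with variance \<open>V\<close>, the characteristic function is bounded by
  \<open>exp (- V (1 - cos u))\<close>, and after centring it differs from \<open>exp (- V u\<^sup>2 / 2)\<close> by at most
  \<open>V (|u|\<^sup>3 + u\<^sup>4)\<close>. The second estimate and Levy's continuity theorem give the central limit
  theorem; together with the first one, which makes dominated convergence applicable to Fourier
  inversion, it gives the local limit theorem. The locale \<open>bernoulli_sums\<close> allows any admissible
  centring and scaling, so that its two theorems apply both to the exact mean and variance and
  to \<open>n / 2\<close> and \<open>n / 12\<close>.\<close>

section \<open>Generalised Eulerian polynomials\<close>

text \<open>Equivalently, \<open>P\<^sub>n(x) / (1 - x)\<^bsup>n + a + b\<^esup>\<close> arises from \<open>(1 - x)\<^bsup>- a - b\<^esup>\<close> by applying \<open>n\<close> times the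
  operator \<open>x d/dx + a\<close>. The classical Eulerian polynomials are the case \<open>a = 1\<close>, \<open>b = 0\<close>.\<close>

primrec eulerian_poly :: "real \<Rightarrow> real \<Rightarrow> nat \<Rightarrow> real poly" where
  "eulerian_poly a b 0 = 1"
| "eulerian_poly a b (Suc n) = [:a, real n + b:] * eulerian_poly a b n + [:0, 1, -1:] * pderiv (eulerian_poly a b n)"

text \<open>Let \<open>K\<^sub>b\<close> be the operator of the recursion, acting on the homogenised polynomials in \<open>x, y\<close> as
  \<open>a y + b x + x y D\<close> with \<open>D = \<partial>\<^sub>x + \<partial>\<^sub>y\<close>, and let \<open>L\<^sub>b = a + b + x D\<close>. The commutator \<open>[L\<^sub>b, K\<^sub>b]\<close> is
  \<open>x L\<^sub>b\<close>, that is \<open>K\<^sub>b\<^sub>+\<^sub>1 L\<^sub>b = L\<^sub>b K\<^sub>b\<close>, and the right-hand side below is \<open>L\<^sub>b\<close> after setting \<open>y = 1\<close>.\<close>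

lemma eulerian_poly_shift:
  "smult (a + b) (eulerian_poly a (b + 1) n) = [:a + b, real n:] * eulerian_poly a b n + [:0, 1, -1:] * pderiv (eulerian_poly a b n)"
proof (induction n)
  case 0
  then show ?case by (simp add: one_pCons)
next
  case (Suc n)
  define F where "F = eulerian_poly a b n"
  define L where "L = [:a + b, real n:] * F + [:0, 1, -1:] * pderiv F"
  define K where "K = [:a, real n + b:] * F + [:0, 1, -1:] * pderiv F"
  have IH: "smult (a + b) (eulerian_poly a (b + 1) n) = L"
    using Suc.IH by (simp add: L_def F_def)
  have "smult (a + b) (eulerian_poly a (b + 1) (Suc n)) = [:a, real n + (b + 1):] * L + [:0, 1, -1:] * pderiv L"
    unfolding IH[symmetric] by (simp only: eulerian_poly.simps smult_add_right pderiv_smult mult_smult_right)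
  also have "\<dots> = [:a + b, real (Suc n):] * K + [:0, 1, -1:] * pderiv K"
  proof (subst poly_eq_poly_eq_iff[symmetric], rule ext)
    fix x
    show "poly ([:a, real n + (b + 1):] * L + [:0, 1, -1:] * pderiv L) x =
      poly ([:a + b, real (Suc n):] * K + [:0, 1, -1:] * pderiv K) x"
      by (simp add: L_def K_def pderiv_add pderiv_mult pderiv_smult pderiv_minus pderiv_pCons) algebra
  qed
  finally show ?case by (simp only: K_def F_def eulerian_poly.simps)
qed

text \<open>Eliminating the derivative with the previous identity leaves the functional equation that
  tableaux satisfy.\<close>

lemma eulerian_poly_Suc_shift:
  "eulerian_poly a b (Suc n) = smult b ([:-1, 1:] * eulerian_poly a b n) + smult (a + b) (eulerian_poly a (b + 1) n)"
  unfolding eulerian_poly_shift by (subst poly_eq_poly_eq_iff[symmetric], rule ext) (simp add: algebra_simps)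

section \<open>Columns that can be attached to a tableau\<close>

definition beta_free_rows :: "nat \<Rightarrow> filling \<Rightarrow> nat set" where
  "beta_free_rows n S = {i \<in> {1..n}. \<forall>j. S (i, j) \<noteq> Some Sym_beta}"

definition columns :: "nat set \<Rightarrow> (nat \<Rightarrow> st_symbol option) set" where
  "columns R = {c. dom c \<subseteq> R \<and> (\<forall>i i'. c i = Some Sym_alpha \<and> i' < i \<longrightarrow> c i' = None)}"

text \<open>If \<open>R\<close> consists of the \<open>\<beta>\<close>-free rows of a tableau and the new row, the last factor records the
  \<open>\<beta>\<close>-free rows of the enlarged tableau. Thus attaching a column multiplies the weights.\<close>

definition column_weight :: "real \<Rightarrow> real \<Rightarrow> real \<Rightarrow> nat set \<Rightarrow> (nat \<Rightarrow> st_symbol option) \<Rightarrow> real" where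
  "column_weight \<alpha> \<beta> u R c = \<alpha> ^ card {i. c i = Some Sym_alpha} * \<beta> ^ card {i. c i = Some Sym_beta}
     * u ^ card (R - {i. c i = Some Sym_beta})"

definition attach_column :: "(nat \<Rightarrow> st_symbol option) \<Rightarrow> filling \<Rightarrow> filling" where
  "attach_column c S = (\<lambda>(i, j). if j = 0 then None else if j = 1 then c i else S (i, j - 1))"

text \<open>Here \<open>m\<close> is meant to be the new bottom row, whose only box is a diagonal one.\<close>

definition full_columns :: "nat \<Rightarrow> nat set \<Rightarrow> (nat \<Rightarrow> st_symbol option) set" where
  "full_columns m R = {c \<in> columns (insert m R). c m \<noteq> None}"

lemma columns_empty: "columns {} = {Map.empty}"
  by (auto simp: columns_def)

text \<open>An \<open>\<alpha>\<close> in the bottom box forces all boxes above it to be empty, whereas a \<open>\<beta>\<close> imposes nothing on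
  them.\<close>

lemma full_columns_eq:
  assumes "\<And>i. i \<in> R \<Longrightarrow> i < m"
  shows "full_columns m R = insert [m \<mapsto> Sym_alpha] ((\<lambda>c. c(m \<mapsto> Sym_beta)) ` columns R)"
proof (intro equalityI subsetI)
  fix c assume c: "c \<in> full_columns m R"
  then obtain s where s: "c m = Some s" by (auto simp: full_columns_def)
  from c have dom: "dom c \<subseteq> insert m R"
    and al: "\<And>i i'. c i = Some Sym_alpha \<Longrightarrow> i' < i \<Longrightarrow> c i' = None"
    by (auto simp: full_columns_def columns_def)
  show "c \<in> insert [m \<mapsto> Sym_alpha] ((\<lambda>c. c(m \<mapsto> Sym_beta)) ` columns R)"
  proof (cases s)
    case Sym_alpha
    have "c i = [m \<mapsto> Sym_alpha] i" for i
      using al[of m i] s Sym_alpha dom assms[of i] by (cases "i = m") (auto simp: dom_def)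
    then show ?thesis by blast
  next
    case Sym_beta
    have "c(m := None) \<in> columns R" using dom al by (auto simp: columns_def dom_def)
    moreover have "c = (c(m := None))(m \<mapsto> Sym_beta)" using s Sym_beta by auto
    ultimately show ?thesis by blast
  qed
next
  fix c assume "c \<in> insert [m \<mapsto> Sym_alpha] ((\<lambda>c. c(m \<mapsto> Sym_beta)) ` columns R)"
  then consider "c = [m \<mapsto> Sym_alpha]" | d where "d \<in> columns R" "c = d(m \<mapsto> Sym_beta)" by blast
  then show "c \<in> full_columns m R"
  proof cases
    case 1
    then show ?thesis by (auto simp: full_columns_def columns_def split: if_splits)
  next
    case 2
    have "i' \<noteq> m" if "d i = Some Sym_alpha" "i' < i" for i i'
      using 2(1) that assms[of i] by (auto simp: columns_def dom_def)
    then show ?thesis using 2 by (fastforce simp: full_columns_def columns_def dom_def split: if_splits)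
  qed
qed

lemma columns_insert:
  assumes "\<And>i. i \<in> R \<Longrightarrow> i < m"
  shows "columns (insert m R) = columns R \<union> full_columns m R"
  by (auto simp: full_columns_def columns_def dom_def)

lemma finite_columns: "finite R \<Longrightarrow> finite (columns R)"
proof (induction R rule: finite_linorder_max_induct)
  case empty
  then show ?case by (simp add: columns_empty)
next
  case (insert m R)
  then show ?case by (simp add: columns_insert full_columns_eq)
qed

lemma finite_full_columns:
  assumes "finite R" "\<And>i. i \<in> R \<Longrightarrow> i < m"
  shows "finite (full_columns m R)"
  using assms by (simp add: full_columns_eq finite_columns)

lemma column_notin: "c \<in> columns R \<Longrightarrow> m \<notin> R \<Longrightarrow> c m = None"
  by (auto simp: columns_def dom_def)

lemma finite_column_dom: "c \<in> columns R \<Longrightarrow> finite R \<Longrightarrow> finite {i. c i = Some s}"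
  by (rule finite_subset[of _ R]) (auto simp: columns_def dom_def)

lemma column_weight_alpha:
  assumes "finite R" "m \<notin> R"
  shows "column_weight \<alpha> \<beta> u (insert m R) [m \<mapsto> Sym_alpha] = \<alpha> * u ^ Suc (card R)"
proof -
  have "{i. [m \<mapsto> Sym_alpha] i = Some Sym_alpha} = {m}" "{i. [m \<mapsto> Sym_alpha] i = Some Sym_beta} = {}"
    by (auto split: if_splits)
  then show ?thesis using assms by (simp add: column_weight_def)
qed

lemma column_weight_beta:
  assumes "finite R" "m \<notin> R" "c \<in> columns R"
  shows "column_weight \<alpha> \<beta> u (insert m R) (c(m \<mapsto> Sym_beta)) = \<beta> * column_weight \<alpha> \<beta> u R c"
proof -
  have cm: "c m = None" using assms column_notin by blast
  have "{i. (c(m \<mapsto> Sym_beta)) i = Some Sym_beta} = insert m {i. c i = Some Sym_beta}"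
    "{i. (c(m \<mapsto> Sym_beta)) i = Some Sym_alpha} = {i. c i = Some Sym_alpha}"
    "insert m R - insert m {i. c i = Some Sym_beta} = R - {i. c i = Some Sym_beta}"
    using cm assms(2) by auto
  then show ?thesis using cm finite_column_dom[OF assms(3,1)] by (simp add: column_weight_def)
qed

lemma column_weight_None:
  assumes "finite R" "m \<notin> R" "c \<in> columns R"
  shows "column_weight \<alpha> \<beta> u (insert m R) c = u * column_weight \<alpha> \<beta> u R c"
proof -
  have cm: "c m = None" using assms column_notin by blast
  have "insert m R - {i. c i = Some Sym_beta} = insert m (R - {i. c i = Some Sym_beta})"
    using cm by auto
  then show ?thesis using assms by (simp add: column_weight_def)
qed

lemma inj_on_upd_column: "m \<notin> R \<Longrightarrow> inj_on (\<lambda>c. c(m \<mapsto> s)) (columns R)"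
proof (rule inj_onI)
  fix c d assume mR: "m \<notin> R" and c: "c \<in> columns R" and d: "d \<in> columns R"
    and eq: "c(m \<mapsto> s) = d(m \<mapsto> s)"
  have "c i = d i" for i
    using column_notin[OF c mR] column_notin[OF d mR] fun_cong[OF eq, of i] by (cases "i = m") auto
  then show "c = d" by blast
qed

lemma sum_full_columns:
  fixes g :: "(nat \<Rightarrow> st_symbol option) \<Rightarrow> 'a::comm_monoid_add"
  assumes "finite R" "\<And>i. i \<in> R \<Longrightarrow> i < m"
  shows "(\<Sum>c\<in>full_columns m R. g c) = g [m \<mapsto> Sym_alpha] + (\<Sum>c\<in>columns R. g (c(m \<mapsto> Sym_beta)))"
proof -
  have m: "m \<notin> R" using assms(2) by blast
  have "[m \<mapsto> Sym_alpha] \<noteq> c(m \<mapsto> Sym_beta)" for c :: "nat \<Rightarrow> st_symbol option"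
  proof
    assume eq: "[m \<mapsto> Sym_alpha] = c(m \<mapsto> Sym_beta)"
    show False using fun_cong[OF eq, of m] by simp
  qed
  then have "[m \<mapsto> Sym_alpha] \<notin> (\<lambda>c. c(m \<mapsto> Sym_beta)) ` columns R"
    by blast
  then show ?thesis
    using assms m by (simp add: full_columns_eq finite_columns sum.reindex inj_on_upd_column)
qed

text \<open>Reading from the bottom, each row of \<open>R\<close> stays empty (factor \<open>u\<close>) or receives \<open>\<beta>\<close>, until possibly an
  \<open>\<alpha>\<close> stops the process and leaves the remaining rows free. Hence adding one row turns the sum \<open>\<Psi>\<close> into
  \<open>(u + \<beta>) \<Psi> + \<alpha> u\<^bsup>r + 1\<^esup>\<close>. The factor \<open>\<beta>\<close> on the left avoids a division in the solution.\<close>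

lemma sum_column_weight:
  assumes "finite R"
  shows "\<beta> * (\<Sum>c\<in>columns R. column_weight \<alpha> \<beta> u R c) = (\<beta> + \<alpha> * u) * (u + \<beta>) ^ card R - \<alpha> * u ^ Suc (card R)"
  using assms
proof (induction R rule: finite_linorder_max_induct)
  case empty
  then show ?case by (simp add: columns_empty column_weight_def)
next
  case (insert m R)
  have m: "m \<notin> R" using insert.hyps by blast
  let ?\<Psi> = "\<Sum>c\<in>columns R. column_weight \<alpha> \<beta> u R c"
  have ins: "columns (insert m R) = columns R \<union> full_columns m R"
    using insert.hyps by (intro columns_insert) blast
  have disj: "columns R \<inter> full_columns m R = {}"
    using m by (auto simp: full_columns_def dest: column_notin)
  have "(\<Sum>c\<in>columns (insert m R). column_weight \<alpha> \<beta> u (insert m R) c)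
     = (\<Sum>c\<in>columns R. column_weight \<alpha> \<beta> u (insert m R) c)
       + (\<Sum>c\<in>full_columns m R. column_weight \<alpha> \<beta> u (insert m R) c)"
    unfolding ins using insert.hyps
    by (intro sum.union_disjoint disj finite_columns finite_full_columns) auto
  also have "\<dots> = u * ?\<Psi> + (\<alpha> * u ^ Suc (card R) + \<beta> * ?\<Psi>)"
    using insert.hyps m
    by (simp add: sum_full_columns column_weight_None column_weight_beta column_weight_alpha sum_distrib_left)
  finally have "\<beta> * (\<Sum>c\<in>columns (insert m R). column_weight \<alpha> \<beta> u (insert m R) c)
     = (u + \<beta>) * (\<beta> * ?\<Psi>) + \<beta> * \<alpha> * u ^ Suc (card R)"
    by (simp only: distrib_left distrib_right mult_ac add_ac)
  also have "\<dots> = (\<beta> + \<alpha> * u) * (u + \<beta>) ^ Suc (card R) - \<alpha> * u ^ Suc (Suc (card R))"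
    unfolding insert.IH by (simp add: algebra_simps)
  finally show ?case unfolding card_insert_disjoint[OF insert.hyps(1) m] .
qed

text \<open>The exponent of the polynomial variable records whether the new diagonal box carries \<open>\<alpha>\<close>.\<close>

lemma sum_full_column_weight:
  assumes "finite R" "\<And>i. i \<in> R \<Longrightarrow> i < m"
  shows "(\<Sum>c\<in>full_columns m R. monom (column_weight \<alpha> \<beta> u (insert m R) c) (if c m = Some Sym_alpha then 1 else 0))
     = smult (\<alpha> * u * u ^ card R) [:-1, 1:] + [:(\<beta> + \<alpha> * u) * (u + \<beta>) ^ card R:]"
proof -
  have m: "m \<notin> R" using assms(2) by blast
  let ?w = "column_weight \<alpha> \<beta> u (insert m R)"
  have "(\<Sum>c\<in>columns R. monom (?w (c(m \<mapsto> Sym_beta))) 0)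
      = monom (\<Sum>c\<in>columns R. ?w (c(m \<mapsto> Sym_beta))) 0"
    by (rule monom_sum[symmetric])
  also have "(\<Sum>c\<in>columns R. ?w (c(m \<mapsto> Sym_beta))) = \<beta> * (\<Sum>c\<in>columns R. column_weight \<alpha> \<beta> u R c)"
    using assms(1) m by (simp add: column_weight_beta sum_distrib_left)
  finally have beta: "(\<Sum>c\<in>columns R. monom (?w (c(m \<mapsto> Sym_beta))) 0)
      = [:(\<beta> + \<alpha> * u) * (u + \<beta>) ^ card R - \<alpha> * u ^ Suc (card R):]"
    by (simp only: sum_column_weight[OF assms(1)] monom_0)
  have "(\<Sum>c\<in>full_columns m R. monom (?w c) (if c m = Some Sym_alpha then 1 else 0))
     = monom (\<alpha> * u ^ Suc (card R)) 1 + (\<Sum>c\<in>columns R. monom (?w (c(m \<mapsto> Sym_beta))) 0)"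
    using sum_full_columns[OF assms, of "\<lambda>c. monom (?w c) (if c m = Some Sym_alpha then 1 else 0)"]
      column_weight_alpha[OF assms(1) m] by simp
  also have "\<dots> = smult (\<alpha> * u * u ^ card R) [:-1, 1:] + [:(\<beta> + \<alpha> * u) * (u + \<beta>) ^ card R:]"
    unfolding beta by (simp add: monom_Suc monom_0)
  finally show ?thesis .
qed

section \<open>The generating polynomial of tableaux by diagonal symbols\<close>

lemma tableau_None:
  assumes "S \<in> staircase_tableaux n" "i = 0 \<or> j = 0 \<or> n + 1 < i + j"
  shows "S (i, j) = None"
proof (rule ccontr)
  assume "S (i, j) \<noteq> None"
  then have "(i, j) \<in> staircase_boxes n" using assms(1) unfolding staircase_tableaux_def by blast
  then show False using assms(2) by (auto simp: staircase_boxes_def)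
qed

lemma tableau_diag:
  assumes "S \<in> staircase_tableaux n" "1 \<le> i" "1 \<le> j" "i + j = n + 1"
  shows "S (i, j) \<noteq> None"
proof -
  have "(i, j) \<in> staircase_boxes n" using assms(2-4) by (simp add: staircase_boxes_def)
  then show ?thesis using assms(1,4) unfolding staircase_tableaux_def by blast
qed

lemma tableau_beta: "S \<in> staircase_tableaux n \<Longrightarrow> S (i, j) = Some Sym_beta \<Longrightarrow> j' < j \<Longrightarrow> S (i, j') = None"
  unfolding staircase_tableaux_def by blast

lemma tableau_alpha: "S \<in> staircase_tableaux n \<Longrightarrow> S (i, j) = Some Sym_alpha \<Longrightarrow> i' < i \<Longrightarrow> S (i', j) = None"
  unfolding staircase_tableaux_def by blast

lemma tableauI:
  assumes "\<And>i j. i = 0 \<or> j = 0 \<or> n + 1 < i + j \<Longrightarrow> S (i, j) = None"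
    and "\<And>i j. 1 \<le> i \<Longrightarrow> 1 \<le> j \<Longrightarrow> i + j = n + 1 \<Longrightarrow> S (i, j) \<noteq> None"
    and "\<And>i j j'. S (i, j) = Some Sym_beta \<Longrightarrow> j' < j \<Longrightarrow> S (i, j') = None"
    and "\<And>i i' j. S (i, j) = Some Sym_alpha \<Longrightarrow> i' < i \<Longrightarrow> S (i', j) = None"
  shows "S \<in> staircase_tableaux n"
proof -
  have "dom S \<subseteq> staircase_boxes n"
  proof
    fix b assume b: "b \<in> dom S"
    obtain i j where ij: "b = (i, j)" by (cases b)
    have "\<not> (i = 0 \<or> j = 0 \<or> n + 1 < i + j)"
    proof
      assume "i = 0 \<or> j = 0 \<or> n + 1 < i + j"
      from assms(1)[OF this] b show False by (simp add: ij dom_def)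
    qed
    then show "b \<in> staircase_boxes n" by (simp add: ij staircase_boxes_def)
  qed
  then show ?thesis using assms(2-4) unfolding staircase_tableaux_def staircase_boxes_def by blast
qed

lemma finite_beta_free_rows: "finite (beta_free_rows n S)"
  by (simp add: beta_free_rows_def)

lemma beta_free_rows_less: "i \<in> beta_free_rows n S \<Longrightarrow> i < Suc n"
  by (simp add: beta_free_rows_def)

lemma attach_column_in:
  assumes S: "S \<in> staircase_tableaux n" and c: "c \<in> full_columns (Suc n) (beta_free_rows n S)"
  shows "attach_column c S \<in> staircase_tableaux (Suc n)"
proof (rule tableauI)
  have dom: "1 \<le> i \<and> i \<le> Suc n \<and> (\<forall>j. S (i, j) \<noteq> Some Sym_beta)" if "c i = Some s" for i s
  proof -
    have "i \<in> insert (Suc n) (beta_free_rows n S)"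
      using c that by (auto simp: full_columns_def columns_def dom_def)
    moreover have "S (Suc n, j) = None" for j using tableau_None[OF S, of "Suc n" j] by (cases j) auto
    ultimately show ?thesis by (auto simp: beta_free_rows_def)
  qed
  have ca: "c i' = None" if "c i = Some Sym_alpha" "i' < i" for i i'
    using c that by (auto simp: full_columns_def columns_def)
  fix i j
  show "attach_column c S (i, j) = None" if "i = 0 \<or> j = 0 \<or> Suc n + 1 < i + j"
  proof (cases "j \<le> 1")
    case True
    then show ?thesis using that dom[of i] by (cases "c i") (auto simp: attach_column_def le_Suc_eq)
  next
    case False
    then have "i = 0 \<or> n + 1 < i + (j - 1)" using that by linarith
    then show ?thesis using False tableau_None[OF S, of i "j - 1"] by (auto simp: attach_column_def)
  qed
  show "attach_column c S (i, j) \<noteq> None" if "1 \<le> i" "1 \<le> j" "i + j = Suc n + 1"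
    using that c tableau_diag[OF S, of i "j - 1"] by (auto simp: attach_column_def full_columns_def)
  show "attach_column c S (i, j') = None" if "attach_column c S (i, j) = Some Sym_beta" "j' < j" for j'
    using that dom[of i] tableau_beta[OF S, of i "j - 1" "j' - 1"]
    by (cases "c i") (auto simp: attach_column_def split: if_splits)
  show "attach_column c S (i', j) = None" if "attach_column c S (i, j) = Some Sym_alpha" "i' < i" for i'
    using that ca[of i i'] tableau_alpha[OF S, of i "j - 1" i'] by (auto simp: attach_column_def split: if_splits)
qed

definition drop_column :: "filling \<Rightarrow> filling" where
  "drop_column S = (\<lambda>(i, j). if j = 0 then None else S (i, Suc j))"

lemma drop_column_in:
  assumes S: "S \<in> staircase_tableaux (Suc n)"
  shows "drop_column S \<in> staircase_tableaux n"
proof (rule tableauI)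
  fix i j
  show "drop_column S (i, j) = None" if "i = 0 \<or> j = 0 \<or> n + 1 < i + j"
    using that tableau_None[OF S, of i "Suc j"] by (auto simp: drop_column_def)
  show "drop_column S (i, j) \<noteq> None" if "1 \<le> i" "1 \<le> j" "i + j = n + 1"
    using that tableau_diag[OF S, of i "Suc j"] by (auto simp: drop_column_def)
  show "drop_column S (i, j') = None" if "drop_column S (i, j) = Some Sym_beta" "j' < j" for j'
    using that tableau_beta[OF S, of i "Suc j" "Suc j'"] by (auto simp: drop_column_def split: if_splits)
  show "drop_column S (i', j) = None" if "drop_column S (i, j) = Some Sym_alpha" "i' < i" for i'
    using that tableau_alpha[OF S, of i "Suc j" i'] by (auto simp: drop_column_def split: if_splits)
qed

lemma first_column_in:
  assumes S: "S \<in> staircase_tableaux (Suc n)"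
  shows "(\<lambda>i. S (i, 1)) \<in> full_columns (Suc n) (beta_free_rows n (drop_column S))"
proof -
  have "i \<in> insert (Suc n) (beta_free_rows n (drop_column S))" if "S (i, 1) = Some s" for i s
  proof (rule ccontr)
    assume *: "i \<notin> insert (Suc n) (beta_free_rows n (drop_column S))"
    have "1 \<le> i" "i \<le> Suc n" using tableau_None[OF S, of i 1] that by force+
    then obtain j where "drop_column S (i, j) = Some Sym_beta"
      using * by (auto simp: beta_free_rows_def)
    then show False using tableau_beta[OF S, of i "Suc j" 1] that
      by (auto simp: drop_column_def split: if_splits)
  qed
  then have "dom (\<lambda>i. S (i, 1)) \<subseteq> insert (Suc n) (beta_free_rows n (drop_column S))"
    by (auto simp: dom_def)
  then show ?thesis
    using tableau_diag[OF S, of "Suc n" 1] tableau_alpha[OF S, of _ 1]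
    by (auto simp: full_columns_def columns_def)
qed

lemma drop_attach_column:
  assumes "S \<in> staircase_tableaux n"
  shows "drop_column (attach_column c S) = S"
  using tableau_None[OF assms] by (auto simp: drop_column_def attach_column_def fun_eq_iff)

lemma attach_drop_column:
  assumes "S \<in> staircase_tableaux (Suc n)"
  shows "attach_column (\<lambda>i. S (i, 1)) (drop_column S) = S"
  using tableau_None[OF assms] by (auto simp: drop_column_def attach_column_def fun_eq_iff)

lemma attach_column_1: "attach_column c S (i, 1) = c i"
  by (simp add: attach_column_def)

text \<open>Removing the first column is a bijection from the tableaux of size \<open>n + 1\<close> to the pairs of a tableau
  of size \<open>n\<close> and a full column over its \<open>\<beta>\<close>-free rows: a box of the first column may be filled only if
  its row contains no \<open>\<beta>\<close>, and the new column constrains no box of the others.\<close>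

lemma sum_tableaux_Suc:
  fixes g :: "filling \<Rightarrow> 'a::comm_monoid_add"
  shows "(\<Sum>S\<in>staircase_tableaux (Suc n). g S)
       = (\<Sum>S\<in>staircase_tableaux n. \<Sum>c\<in>full_columns (Suc n) (beta_free_rows n S). g (attach_column c S))"
proof -
  have fin: "finite (full_columns (Suc n) (beta_free_rows n S))" for S
    by (rule finite_full_columns[OF finite_beta_free_rows beta_free_rows_less])
  have "(\<Sum>S\<in>staircase_tableaux (Suc n). g S)
     = (\<Sum>(S, c)\<in>(SIGMA S:staircase_tableaux n. full_columns (Suc n) (beta_free_rows n S)). g (attach_column c S))"
    by (rule sum.reindex_bij_witness[of _ "\<lambda>(S, c). attach_column c S" "\<lambda>S. (drop_column S, \<lambda>i. S (i, 1))"])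
      (use attach_drop_column first_column_in in
        \<open>auto simp: drop_attach_column drop_column_in attach_column_in attach_column_1 simp del: One_nat_def\<close>)
  then show ?thesis
    by (simp add: sum.Sigma finite_staircase_tableaux fin)
qed

lemma finite_symbols:
  assumes "S \<in> staircase_tableaux n"
  shows "finite {b. S b = Some s}"
  using assms by (intro finite_subset[OF _ finite_staircase_boxes[of n]]) (auto simp: staircase_tableaux_def)

lemma num_symbols_attach:
  assumes S: "S \<in> staircase_tableaux n" and c: "c \<in> full_columns (Suc n) (beta_free_rows n S)"
  shows "num_symbols s (attach_column c S) = card {i. c i = Some s} + num_symbols s S"
proof -
  let ?A = "(\<lambda>i. (i, 1)) ` {i. c i = Some s}" and ?B = "(\<lambda>(i, j). (i, Suc j)) ` {b. S b = Some s}"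
  have "{b. attach_column c S b = Some s} = ?A \<union> ?B"
    using tableau_None[OF S] by (force simp: attach_column_def image_iff split: if_splits)
  moreover have "?A \<inter> ?B = {}" using tableau_None[OF S] by auto
  moreover have "finite {i. c i = Some s}"
    using c finite_column_dom finite_beta_free_rows by (auto simp: full_columns_def)
  moreover have "inj_on (\<lambda>i. (i, 1::nat)) {i. c i = Some s}" "inj_on (\<lambda>(i, j). (i, Suc j)) {b. S b = Some s}"
    by (auto simp: inj_on_def)
  ultimately show ?thesis
    using finite_symbols[OF S] unfolding num_symbols_def by (simp add: card_Un_disjoint card_image)
qed

text \<open>Diagonal boxes stay diagonal when the columns are shifted by one.\<close>

lemma diag_alphas_attach:
  assumes S: "S \<in> staircase_tableaux n" and c: "c \<in> full_columns (Suc n) (beta_free_rows n S)"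
  shows "diag_alphas (Suc n) (attach_column c S)
       = (if c (Suc n) = Some Sym_alpha then 1 else 0) + diag_alphas n S"
proof -
  let ?A = "{b. b = (Suc n, 1) \<and> c (Suc n) = Some Sym_alpha}"
    and ?D = "{(i, j). i + j = n + 1 \<and> S (i, j) = Some Sym_alpha}"
  let ?B = "(\<lambda>(i, j). (i, Suc j)) ` ?D"
  have "{(i, j). i + j = Suc n + 1 \<and> attach_column c S (i, j) = Some Sym_alpha} = ?A \<union> ?B"
    using tableau_None[OF S] by (force simp: attach_column_def image_iff split: if_splits)
  moreover have "?A \<inter> ?B = {}" using tableau_None[OF S] by auto
  moreover have "finite ?D" using finite_subset[OF _ finite_symbols[OF S, of Sym_alpha], of ?D] by auto
  moreover have "inj_on (\<lambda>(i, j). (i, Suc j)) ?D" by (auto simp: inj_on_def)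
  ultimately show ?thesis
    unfolding diag_alphas_def by (simp add: card_Un_disjoint card_image)
qed

lemma beta_free_rows_attach:
  assumes S: "S \<in> staircase_tableaux n" and c: "c \<in> full_columns (Suc n) (beta_free_rows n S)"
  shows "beta_free_rows (Suc n) (attach_column c S)
       = insert (Suc n) (beta_free_rows n S) - {i. c i = Some Sym_beta}"
proof -
  have last: "S (Suc n, j) = None" for j
    using tableau_None[OF S, of "Suc n" j] by (cases j) auto
  have "(\<forall>j. attach_column c S (i, j) \<noteq> Some Sym_beta)
     \<longleftrightarrow> c i \<noteq> Some Sym_beta \<and> (\<forall>j. S (i, j) \<noteq> Some Sym_beta)" (is "?l \<longleftrightarrow> ?r") for i
  proof
    assume l: ?l
    show ?r
    proof (intro conjI allI)
      show "c i \<noteq> Some Sym_beta" using l[rule_format, of 1] by (simp add: attach_column_def)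
      show "S (i, j) \<noteq> Some Sym_beta" for j
        using l[rule_format, of "Suc j"] tableau_None[OF S, of i j] by (cases j) (auto simp: attach_column_def)
    qed
  qed (auto simp: attach_column_def)
  then show ?thesis using last by (auto simp: beta_free_rows_def le_Suc_eq)
qed

lemma smult_sum_right: "smult c (\<Sum>i\<in>A. f i) = (\<Sum>i\<in>A. smult c (f i))"
  by (induction A rule: infinite_finite_induct) (simp_all add: smult_add_right)

text \<open>The marking by \<open>u\<close> is what makes a recursion in \<open>n\<close> possible.\<close>

definition tableau_poly :: "nat \<Rightarrow> real \<Rightarrow> real \<Rightarrow> real \<Rightarrow> real poly" where
  "tableau_poly n \<alpha> \<beta> u =
     (\<Sum>S\<in>staircase_tableaux n. monom (tableau_weight \<alpha> \<beta> S * u ^ card (beta_free_rows n S)) (diag_alphas n S))"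

text \<open>A tableau with \<open>r\<close> rows free of \<open>\<beta>\<close> contributes \<open>u\<^bsup>r\<^esup>\<close>, and summing over its full columns turns this into
  a combination of \<open>u\<^bsup>r\<^esup>\<close> and \<open>(u + \<beta>)\<^bsup>r\<^esup>\<close>.\<close>

lemma tableau_poly_Suc:
  "tableau_poly (Suc n) \<alpha> \<beta> u
     = smult (\<alpha> * u) ([:-1, 1:] * tableau_poly n \<alpha> \<beta> u) + smult (\<beta> + \<alpha> * u) (tableau_poly n \<alpha> \<beta> (u + \<beta>))"
proof -
  let ?w = "\<lambda>S. monom (tableau_weight \<alpha> \<beta> S) (diag_alphas n S)"
  have "tableau_poly (Suc n) \<alpha> \<beta> u = (\<Sum>S\<in>staircase_tableaux n. ?w S *
     (\<Sum>c\<in>full_columns (Suc n) (beta_free_rows n S).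
        monom (column_weight \<alpha> \<beta> u (insert (Suc n) (beta_free_rows n S)) c) (if c (Suc n) = Some Sym_alpha then 1 else 0)))"
    unfolding tableau_poly_def sum_tableaux_Suc sum_distrib_left
    by (intro sum.cong refl)
      (simp add: tableau_weight_def column_weight_def num_symbols_attach diag_alphas_attach
        beta_free_rows_attach mult_monom power_add mult_ac add_ac del: One_nat_def)
  also have "\<dots> = (\<Sum>S\<in>staircase_tableaux n. ?w S *
     (smult (\<alpha> * u * u ^ card (beta_free_rows n S)) [:-1, 1:]
      + [:(\<beta> + \<alpha> * u) * (u + \<beta>) ^ card (beta_free_rows n S):]))"
    by (simp only: sum_full_column_weight[OF finite_beta_free_rows beta_free_rows_less])
  also have "\<dots> = (\<Sum>S\<in>staircase_tableaux n.
      smult (\<alpha> * u) ([:-1, 1:] * monom (tableau_weight \<alpha> \<beta> S * u ^ card (beta_free_rows n S)) (diag_alphas n S))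
      + smult (\<beta> + \<alpha> * u) (monom (tableau_weight \<alpha> \<beta> S * (u + \<beta>) ^ card (beta_free_rows n S)) (diag_alphas n S)))"
    by (intro sum.cong refl, subst poly_eq_poly_eq_iff[symmetric], rule ext)
      (simp add: poly_monom algebra_simps)
  finally show ?thesis
    by (simp only: tableau_poly_def sum.distrib smult_sum_right sum_distrib_left)
qed

lemma tableau_poly_0: "tableau_poly 0 \<alpha> \<beta> u = 1"
proof -
  have boxes: "staircase_boxes 0 = {}" by (auto simp: staircase_boxes_def)
  have "staircase_tableaux 0 = {Map.empty}"
    using boxes by (auto simp: staircase_tableaux_def)
  then show ?thesis
    by (simp add: tableau_poly_def tableau_weight_def num_symbols_def diag_alphas_def beta_free_rows_def)
qed

text \<open>Both sides satisfy the same recursion in \<open>n\<close>, because the shift \<open>u \<mapsto> u + \<beta>\<close> increases \<open>u / \<beta>\<close> by one.\<close>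

lemma tableau_poly_eq_eulerian_poly:
  assumes "\<alpha> > 0" "\<beta> > 0"
  shows "tableau_poly n \<alpha> \<beta> u = smult ((\<alpha> * \<beta>) ^ n) (eulerian_poly (1 / \<alpha>) (u / \<beta>) n)"
proof (induction n arbitrary: u)
  case 0
  then show ?case by (simp add: tableau_poly_0)
next
  case (Suc n)
  have u: "(u + \<beta>) / \<beta> = u / \<beta> + 1" using assms by (simp add: field_simps)
  show ?case
    unfolding tableau_poly_Suc Suc.IH eulerian_poly_Suc_shift u
    using assms by (subst poly_eq_poly_eq_iff[symmetric], intro ext) (simp add: field_simps)
qed

section \<open>Real-rootedness and Bernoulli products\<close>

text \<open>The Eulerian polynomials divided by their value at \<open>1\<close>. The first step has its own parameter \<open>p\<close>,
  the probability of an \<open>\<alpha>\<close> for \<open>n = 1\<close>: it equals \<open>b / (a + b)\<close> if \<open>a + b > 0\<close>, but for \<open>a = b = 0\<close>,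
  that is for two infinite parameters, the recursion cannot determine it.\<close>

primrec diag_poly :: "real \<Rightarrow> real \<Rightarrow> real \<Rightarrow> nat \<Rightarrow> real poly" where
  "diag_poly a b p 0 = 1"
| "diag_poly a b p (Suc n) = (if n = 0 then [:1 - p, p:]
     else smult (1 / (real n + a + b))
       ([:a, real n + b:] * diag_poly a b p n + [:0, 1, -1:] * pderiv (diag_poly a b p n)))"

lemma coeff_euler_step:
  "coeff ([:a, m:] * F + [:0, 1, -1:] * pderiv F) k
     = (real k + a) * coeff F k + (if k = 0 then 0 else (m - (real k - 1)) * coeff F (k - 1))"
  by (cases k; cases "k - 1") (simp_all add: coeff_pCons coeff_pderiv algebra_simps split: nat.splits)

lemma degree_diag_poly: "degree (diag_poly a b p n) \<le> n"
proof (induction n)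
  case (Suc n)
  have "coeff (diag_poly a b p (Suc n)) k = 0" if "k > Suc n" for k
  proof (cases "n = 0")
    case True
    then show ?thesis using that by (simp add: coeff_pCons split: nat.splits)
  next
    case False
    have "coeff (diag_poly a b p n) k = 0" "coeff (diag_poly a b p n) (k - 1) = 0"
      using Suc that by (intro coeff_eq_0; linarith)+
    then show ?thesis using False that by (simp only: diag_poly.simps if_False coeff_smult coeff_euler_step) simp
  qed
  then show ?case by (intro degree_le) blast
qed simp

lemma poly_diag_poly_1:
  assumes "a \<ge> 0" "b \<ge> 0"
  shows "poly (diag_poly a b p n) 1 = 1"
proof (induction n)
  case (Suc n)
  then show ?case using assms by (cases "n = 0") (simp_all add: field_simps)
qed simp

abbreviation cpoly :: "real poly \<Rightarrow> complex poly" where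
  "cpoly \<equiv> map_poly complex_of_real"

lemma cpoly_add: "cpoly (p + q) = cpoly p + cpoly q"
  by (rule poly_eqI) (simp add: coeff_map_poly)

lemma cpoly_mult: "cpoly (p * q) = cpoly p * cpoly q"
  by (rule poly_eqI) (simp add: coeff_map_poly coeff_mult)

lemma cpoly_smult: "cpoly (smult c p) = smult (of_real c) (cpoly p)"
  by (rule poly_eqI) (simp add: coeff_map_poly)

lemma cpoly_pderiv: "cpoly (pderiv p) = pderiv (cpoly p)"
  by (rule poly_eqI) (simp add: coeff_map_poly coeff_pderiv)

lemma poly_cpoly_of_real: "poly (cpoly p) (of_real x) = of_real (poly p x)"
  by (induction p) (simp_all add: map_poly_pCons)

text \<open>The probability generating function of a sum of independent Bernoulli variables with success
  probabilities \<open>qs\<close>.\<close>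

definition bernoulli_prod :: "real list \<Rightarrow> real poly" where
  "bernoulli_prod qs = prod_list (map (\<lambda>q. [:1 - q, q:]) qs)"

lemma bernoulli_prod_simps [simp]:
  "bernoulli_prod [] = 1"
  "bernoulli_prod (q # qs) = [:1 - q, q:] * bernoulli_prod qs"
  by (simp_all add: bernoulli_prod_def)

lemma poly_bernoulli_prod:
  "poly (cpoly (bernoulli_prod qs)) z = (\<Prod>q\<leftarrow>qs. 1 - of_real q + of_real q * z)"
proof (induction qs)
  case (Cons q qs)
  have "poly (cpoly (bernoulli_prod (q # qs))) z
      = poly (cpoly [:1 - q, q:]) z * poly (cpoly (bernoulli_prod qs)) z"
    unfolding bernoulli_prod_simps cpoly_mult poly_mult ..
  also have "poly (cpoly [:1 - q, q:]) z = 1 - of_real q + of_real q * z"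
    by (simp add: map_poly_pCons)
  finally show ?case by (simp only: Cons.IH list.map prod_list.Cons)
qed simp

text \<open>A root \<open>r \<le> 0\<close> contributes the factor \<open>(x - r) / (1 - r) = 1 - q + q x\<close> with \<open>q = 1 / (1 - r)\<close>, and
  the value \<open>1\<close> at \<open>1\<close> excludes any further constant.\<close>

lemma real_rooted_imp_bernoulli_prod:
  assumes "\<And>z. poly (cpoly F) z = 0 \<Longrightarrow> Im z = 0" "\<And>x. x > 0 \<Longrightarrow> poly F x \<noteq> 0" "poly F 1 = 1"
  shows "\<exists>qs. length qs = degree F \<and> set qs \<subseteq> {0..1} \<and> F = bernoulli_prod qs"
  using assms
proof (induction "degree F" arbitrary: F)
  case 0
  then obtain c where "F = [:c:]" by (metis degree_eq_zeroE)
  with 0 have "F = 1" by (simp add: one_pCons)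
  then show ?case by (intro exI[of _ "[]"]) simp
next
  case (Suc d)
  have "degree (cpoly F) = Suc d" using Suc.hyps(2) by (simp add: degree_map_poly)
  then have "\<not> constant (poly (cpoly F))" by (simp add: constant_degree)
  then obtain z where z: "poly (cpoly F) z = 0" using fundamental_theorem_of_algebra by blast
  define r where "r = Re z"
  have zr: "z = of_real r" using Suc.prems(1)[OF z] by (simp add: r_def complex_eq_iff)
  have Fr: "poly F r = 0" using z unfolding zr poly_cpoly_of_real by simp
  then have r: "r \<le> 0" using Suc.prems(2)[of r] by linarith
  from Fr obtain H where H: "F = [:- r, 1:] * H" by (auto simp: poly_eq_0_iff_dvd dvd_def)
  \<comment> \<open>normalises the linear factor to have the value \<open>1\<close> at \<open>1\<close>\<close>
  define q where "q = 1 / (1 - r)"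
  define G where "G = smult (1 - r) H"
  have q: "0 \<le> q" "q \<le> 1" "q \<noteq> 0" using r by (auto simp: q_def)
  have FG: "F = [:1 - q, q:] * G"
    using r by (subst poly_eq_poly_eq_iff[symmetric], intro ext) (simp add: H G_def q_def field_simps)
  have "F \<noteq> 0" using Suc.prems(3) by auto
  then have "degree F = Suc (degree G)"
    using FG q by (subst FG, subst degree_mult_eq) auto
  then have dG: "d = degree G" using Suc.hyps(2) by simp
  have "\<exists>qs. length qs = degree G \<and> set qs \<subseteq> {0..1} \<and> G = bernoulli_prod qs"
  proof (rule Suc.hyps(1)[OF dG])
    show "Im z = 0" if "poly (cpoly G) z = 0" for z
      using that by (intro Suc.prems(1)) (simp only: FG cpoly_mult poly_mult mult_zero_right)
    show "poly G x \<noteq> 0" if "x > 0" for x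
      using Suc.prems(2)[OF that] by (auto simp: FG)
    show "poly G 1 = 1" using Suc.prems(3) by (simp add: FG algebra_simps)
  qed
  then obtain qs where "length qs = degree G" "set qs \<subseteq> {0..1}" "G = bernoulli_prod qs" by blast
  then show ?case using FG q dG Suc.hyps(2) by (intro exI[of _ "q # qs"]) simp
qed

text \<open>The logarithmic derivative, multiplied by \<open>z (1 - z)\<close>. The form of the right-hand side comes from
  \<open>(1 - z) q / (1 - q + q z) = 1 / (1 - q + q z) - 1\<close>.\<close>

lemma pderiv_bernoulli_prod:
  fixes z :: complex
  assumes "\<And>q. q \<in> set qs \<Longrightarrow> 1 - of_real q + of_real q * z \<noteq> 0"
  shows "z * (1 - z) * poly (pderiv (cpoly (bernoulli_prod qs))) z
    = poly (cpoly (bernoulli_prod qs)) z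
      * ((\<Sum>q\<leftarrow>qs. z / (1 - of_real q + of_real q * z)) - of_nat (length qs) * z)"
  using assms
proof (induction qs)
  case (Cons q qs)
  let ?B = "cpoly (bernoulli_prod qs)" and ?f = "1 - of_real q + of_real q * z"
  let ?S = "(\<Sum>q\<leftarrow>qs. z / (1 - of_real q + of_real q * z)) - of_nat (length qs) * z"
  have f: "?f \<noteq> 0" using Cons.prems by simp
  have IH: "z * (1 - z) * poly (pderiv ?B) z = poly ?B z * ?S" using Cons by simp
  have "z * (1 - z) * poly (pderiv (cpoly (bernoulli_prod (q # qs)))) z
    = ?f * (z * (1 - z) * poly (pderiv ?B) z) + poly ?B z * (z * (of_real q * (1 - z)))"
    unfolding bernoulli_prod_simps cpoly_mult pderiv_mult
    by (simp add: map_poly_pCons pderiv_pCons algebra_simps)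
  also have "of_real q * (1 - z) = 1 - ?f" by (simp add: algebra_simps)
  also have "?f * (z * (1 - z) * poly (pderiv ?B) z) + poly ?B z * (z * (1 - ?f))
     = ?f * poly ?B z * (?S + z / ?f - z)"
    unfolding IH using f by (simp add: field_simps)
  also have "?f * poly ?B z = poly (cpoly (bernoulli_prod (q # qs))) z"
    by (simp only: poly_bernoulli_prod list.map prod_list.Cons)
  finally show ?case by (simp add: algebra_simps)
qed (simp add: map_poly_1')

lemma bernoulli_factor_nonzero:
  assumes "0 \<le> q" "q \<le> 1" "Im z \<noteq> 0 \<or> (\<exists>x>0. z = of_real x)"
  shows "1 - of_real q + of_real q * z \<noteq> (0 :: complex)"
  using assms(3)
proof
  assume "Im z \<noteq> 0"
  then show ?thesis by (cases "q = 0") (auto simp: complex_eq_iff)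
next
  assume "\<exists>x>0. z = of_real x"
  then obtain x where x: "x > 0" "z = of_real x" by blast
  have "1 - q + q * x > 0" using x assms(1,2) by (cases "q = 1") (auto intro: add_pos_nonneg)
  then have "complex_of_real (1 - q + q * x) \<noteq> 0" by (metis less_irrefl of_real_eq_0_iff)
  then show ?thesis by (simp add: x)
qed

text \<open>The factor multiplying \<open>Im z\<close> is nonnegative for \<open>q \<le> 1\<close>, whatever \<open>z\<close> is.\<close>

lemma Im_bernoulli_quotient:
  "Im (z / (1 - of_real q + of_real q * z)) = Im z * ((1 - q) / (cmod (1 - of_real q + of_real q * z))\<^sup>2)"
proof -
  let ?w = "1 - complex_of_real q + complex_of_real q * z"
  have "Im z * Re ?w - Re z * Im ?w = Im z * (1 - q)" by (simp add: algebra_simps)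
  then show ?thesis unfolding Im_divide cmod_power2[symmetric] by (simp only: times_divide_eq_right)
qed

lemma Im_sum_list: "Im (\<Sum>x\<leftarrow>xs. f x) = (\<Sum>x\<leftarrow>xs. Im (f x))"
  by (induction xs) simp_all

text \<open>Up to normalisation, this is the factor by which one step of the recursion multiplies a Bernoulli
  product. For non-real \<open>z\<close> no term has an imaginary part of the sign opposite to \<open>Im z\<close>. All imaginary
  parts vanish only in the degenerate case where every \<open>q\<close> is \<open>1\<close>, and then the factor is a positive
  number. For \<open>z > 0\<close> all terms are nonnegative and one of them is positive.\<close>

lemma logderiv_bracket_nonzero:
  assumes qs: "set qs \<subseteq> {0..1}" "length qs \<le> n" "n > 0" and ab: "a \<ge> 0" "b \<ge> 0"
    and z: "Im z \<noteq> 0 \<or> (\<exists>x>0. z = of_real x)"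
  shows "of_real (real n - real (length qs) + b) * z + of_real a
    + (\<Sum>q\<leftarrow>qs. z / (1 - of_real q + of_real q * z)) \<noteq> 0" (is "?T \<noteq> 0")
  using z
proof
  assume Imz: "Im z \<noteq> 0"
  let ?h = "\<lambda>q. (1 - q) / (cmod (1 - of_real q + of_real q * z))\<^sup>2"
  have h: "?h q \<ge> 0" if "q \<in> set qs" for q using that qs(1) by auto
  show ?thesis
  proof
    assume T: "?T = 0"
    define X where "X = (real n - real (length qs) + b) + (\<Sum>q\<leftarrow>qs. ?h q)"
    have "Im ?T = Im z * X" unfolding X_def
      by (simp only: plus_complex.simps Im_sum_list Im_bernoulli_quotient sum_list_const_mult)
        (simp add: distrib_left mult.commute)
    then have "X = 0" using Imz unfolding T zero_complex.sel by simp
    then have 0: "(real n - real (length qs) + b) + (\<Sum>q\<leftarrow>qs. ?h q) = 0"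
      by (simp only: X_def)
    \<comment> \<open>a sum of nonnegative terms vanishes, hence so does each of them\<close>
    have "(\<Sum>q\<leftarrow>qs. ?h q) \<ge> 0" using h by (intro sum_list_nonneg) auto
    then have b0: "real n - real (length qs) + b = 0" and sum0: "(\<Sum>q\<leftarrow>qs. ?h q) = 0"
      using 0 qs(2) ab(2) by linarith+
    have "\<forall>y\<in>set (map ?h qs). y = 0"
      using sum0 h by (subst sum_list_nonneg_eq_0_iff[symmetric]) auto
    then have h0: "?h q = 0" if "q \<in> set qs" for q using that by simp
    have q1: "q = 1" if q: "q \<in> set qs" for q
    proof -
      have "1 - of_real q + of_real q * z \<noteq> 0"
        using q qs(1) by (intro bernoulli_factor_nonzero z) auto
      then show ?thesis using h0[OF q] by (simp only: divide_eq_0_iff power_eq_0_iff norm_eq_zero) simp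
    qed
    have "(\<Sum>q\<leftarrow>qs. z / (1 - of_real q + of_real q * z)) = (\<Sum>q\<leftarrow>qs. 1)"
    proof (intro arg_cong[where f = sum_list] map_cong refl)
      fix q assume "q \<in> set qs"
      from q1[OF this] show "z / (1 - of_real q + of_real q * z) = 1" using Imz by auto
    qed
    then have "?T = of_real (a + real (length qs))"
      using b0 by (simp add: sum_list_triv)
    moreover have "a + real (length qs) > 0" using b0 ab qs(2,3) by linarith
    ultimately show False using T by (metis less_irrefl of_real_eq_0_iff)
  qed
next
  assume "\<exists>x>0. z = of_real x"
  then obtain x where x: "x > 0" "z = of_real x" by blast
  have pos: "x / (1 - q + q * x) > 0" if "q \<in> set qs" for q
  proof -
    have "0 \<le> q" "q \<le> 1" using that qs(1) by auto
    then have "1 - q + q * x > 0" using x by (cases "q = 1") (auto intro: add_pos_nonneg)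
    then show ?thesis using x by simp
  qed
  have "(\<Sum>q\<leftarrow>qs. z / (1 - of_real q + of_real q * z)) = of_real (\<Sum>q\<leftarrow>qs. x / (1 - q + q * x))"
    unfolding x by (induction qs) simp_all
  then have "?T = of_real ((real n - real (length qs) + b) * x + a + (\<Sum>q\<leftarrow>qs. x / (1 - q + q * x)))"
    by (simp add: x)
  moreover have "(real n - real (length qs) + b) * x + a + (\<Sum>q\<leftarrow>qs. x / (1 - q + q * x)) > 0"
  proof (cases qs)
    case Nil
    then show ?thesis using x qs(3) ab by (auto intro!: add_pos_nonneg mult_pos_pos)
  next
    case (Cons q rs)
    have "(\<Sum>q\<leftarrow>rs. x / (1 - q + q * x)) \<ge> 0"
      using pos Cons by (intro sum_list_nonneg) (auto intro: less_imp_le)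
    moreover have "x / (1 - q + q * x) > 0" using pos Cons by simp
    ultimately have "(\<Sum>q\<leftarrow>qs. x / (1 - q + q * x)) > 0" using Cons by simp
    moreover have "(real n - real (length qs) + b) * x \<ge> 0" using x qs(2) ab by simp
    ultimately show ?thesis using ab by linarith
  qed
  ultimately show ?thesis by (metis less_irrefl of_real_eq_0_iff)
qed

text \<open>By the preceding lemma a step of the recursion creates neither non-real nor positive roots, so
  the product form is inherited from \<open>n\<close> to \<open>n + 1\<close>.\<close>

theorem diag_poly_bernoulli_prod:
  assumes ab: "a \<ge> 0" "b \<ge> 0" and p: "0 \<le> p" "p \<le> 1"
  shows "\<exists>qs. length qs \<le> n \<and> set qs \<subseteq> {0..1} \<and> diag_poly a b p n = bernoulli_prod qs"
proof (induction n)
  case 0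
  then show ?case by (intro exI[of _ "[]"]) simp
next
  case (Suc n)
  show ?case
  proof (cases "n = 0")
    case True
    then show ?thesis using p by (intro exI[of _ "[p]"]) simp
  next
    case False
    from Suc obtain qs where qs: "length qs \<le> n" "set qs \<subseteq> {0..1}" "diag_poly a b p n = bernoulli_prod qs"
      by blast
    let ?F = "diag_poly a b p (Suc n)"
    have nz: "poly (cpoly ?F) z \<noteq> 0" if z: "Im z \<noteq> 0 \<or> (\<exists>x>0. z = of_real x)" for z
    proof -
      let ?B = "cpoly (bernoulli_prod qs)"
      have fac: "1 - of_real q + of_real q * z \<noteq> 0" if "q \<in> set qs" for q
        using that qs(2) z by (intro bernoulli_factor_nonzero) auto
      have B: "poly ?B z \<noteq> 0"
        using fac by (force simp: poly_bernoulli_prod prod_list_zero_iff)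
      let ?T = "of_real (real n - real (length qs) + b) * z + of_real a
        + (\<Sum>q\<leftarrow>qs. z / (1 - of_real q + of_real q * z))"
      have "of_real (real n + a + b) * poly (cpoly ?F) z
        = (of_real a + of_real (real n + b) * z) * poly ?B z + z * (1 - z) * poly (pderiv ?B) z"
      proof -
        have "cpoly ?F = smult (of_real (1 / (real n + a + b)))
           (cpoly [:a, real n + b:] * ?B + cpoly [:0, 1, -1:] * pderiv ?B)"
          using False by (simp only: diag_poly.simps if_False qs(3) cpoly_smult cpoly_add cpoly_mult cpoly_pderiv)
        moreover have "complex_of_real (real n + a + b) * of_real (1 / (real n + a + b)) = 1"
          using False ab unfolding of_real_mult[symmetric] by simp
        ultimately have "of_real (real n + a + b) * poly (cpoly ?F) z
           = poly (cpoly [:a, real n + b:] * ?B + cpoly [:0, 1, -1:] * pderiv ?B) z"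
          by (simp only: poly_smult mult.assoc[symmetric]) simp
        then show ?thesis by (simp add: map_poly_pCons algebra_simps)
      qed
      also have "\<dots> = poly ?B z * ?T"
        by (subst pderiv_bernoulli_prod[OF fac]) (simp_all add: algebra_simps)
      also have "\<dots> \<noteq> 0"
        using B logderiv_bracket_nonzero[OF qs(2,1) _ ab z] False by simp
      finally show ?thesis by (metis mult_zero_right)
    qed
    have "\<exists>rs. length rs = degree ?F \<and> set rs \<subseteq> {0..1} \<and> ?F = bernoulli_prod rs"
    proof (rule real_rooted_imp_bernoulli_prod)
      show "Im z = 0" if "poly (cpoly ?F) z = 0" for z using nz that by blast
      show "poly ?F x \<noteq> 0" if "x > 0" for x
        using nz[of "of_real x"] that unfolding poly_cpoly_of_real by auto
      show "poly ?F 1 = 1" by (rule poly_diag_poly_1[OF ab])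
    qed
    then show ?thesis using degree_diag_poly[of a b p "Suc n"] by metis
  qed
qed

section \<open>Mean and variance\<close>

lemma pderiv_euler_step:
  fixes F :: "real poly"
  assumes "poly F 1 = 1"
  shows "poly (pderiv ([:a, m:] * F + [:0, 1, -1:] * pderiv F)) 1 = m + (a + m - 1) * poly (pderiv F) 1"
    "poly (pderiv (pderiv ([:a, m:] * F + [:0, 1, -1:] * pderiv F))) 1
       = 2 * (m - 1) * poly (pderiv F) 1 + (a + m - 2) * poly (pderiv (pderiv F)) 1"
  using assms by (simp_all add: pderiv_mult pderiv_add pderiv_diff pderiv_minus pderiv_smult pderiv_pCons algebra_simps)

lemma diag_poly_step:
  assumes "n > 0" "a \<ge> 0" "b \<ge> 0"
  shows "smult (real n + a + b) (diag_poly a b p (Suc n))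
    = [:a, real n + b:] * diag_poly a b p n + [:0, 1, -1:] * pderiv (diag_poly a b p n)"
proof -
  have "(real n + a + b) * (1 / (real n + a + b)) = 1" "n \<noteq> 0" using assms by auto
  then show ?thesis by (simp only: diag_poly.simps if_False smult_smult smult_1_left)
qed

text \<open>By the derivative of the recursion at \<open>1\<close>, passing from \<open>n\<close> to \<open>n + 1\<close> increases the left-hand side
  by \<open>n + 1 + b\<close>. The relation between \<open>a\<close>, \<open>b\<close> and \<open>p\<close> starts the induction.\<close>

lemma diag_poly_first_moment:
  assumes ab: "a \<ge> 0" "b \<ge> 0" "(a + b) * p = b"
  shows "(real n + a + b) * poly (pderiv (diag_poly a b p (Suc n))) 1
      = real (Suc n) * real n / 2 + real (Suc n) * b"
proof (induction n)
  case 0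
  then show ?case using ab(3) by (simp add: pderiv_pCons)
next
  case (Suc n)
  let ?F = "diag_poly a b p (Suc n)"
  have "(real (Suc n) + a + b) * poly (pderiv (diag_poly a b p (Suc (Suc n)))) 1
     = poly (pderiv ([:a, real (Suc n) + b:] * ?F + [:0, 1, -1:] * pderiv ?F)) 1"
    by (simp only: diag_poly_step[OF zero_less_Suc ab(1,2), symmetric] pderiv_smult poly_smult)
  also have "\<dots> = (real (Suc n) + b) + (real n + a + b) * poly (pderiv ?F) 1"
    using pderiv_euler_step(1)[OF poly_diag_poly_1[OF ab(1,2)], of a "real (Suc n) + b" p "Suc n"]
    by (simp only: of_nat_Suc algebra_simps) 
  finally show ?case unfolding Suc.IH by (simp add: field_simps)
qed

text \<open>The second derivative of the recursion at \<open>1\<close> telescopes after multiplication by \<open>n + a + b\<close>: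
  passing from \<open>n\<close> to \<open>n + 1\<close> increases the left-hand side by \<open>(n + 1) (n + b) (n + 2 b)\<close>.\<close>

lemma diag_poly_second_moment:
  assumes ab: "a \<ge> 0" "b \<ge> 0" "(a + b) * p = b"
  shows "(real n + a + b) * (real n - 1 + a + b) * poly (pderiv (pderiv (diag_poly a b p (Suc n)))) 1
      = real (Suc n) * real n * (real n - 1) * (real n - 2) / 4
        + (1 / 3 + b) * (real (Suc n) * real n * (real n - 1)) + b\<^sup>2 * (real (Suc n) * real n)"
proof (induction n)
  case 0
  then show ?case by (simp add: pderiv_pCons)
next
  case (Suc n)
  let ?F = "diag_poly a b p (Suc n)"
  have "(real (Suc n) + a + b) * poly (pderiv (pderiv (diag_poly a b p (Suc (Suc n))))) 1
     = poly (pderiv (pderiv ([:a, real (Suc n) + b:] * ?F + [:0, 1, -1:] * pderiv ?F))) 1"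
    by (simp only: diag_poly_step[OF zero_less_Suc ab(1,2), symmetric] pderiv_smult poly_smult)
  also have "\<dots> = 2 * (real n + b) * poly (pderiv ?F) 1 + (real n - 1 + a + b) * poly (pderiv (pderiv ?F)) 1"
    using pderiv_euler_step(2)[OF poly_diag_poly_1[OF ab(1,2)], of a "real (Suc n) + b" p "Suc n"]
    by (simp only: of_nat_Suc) (simp add: algebra_simps)
  finally have "(real (Suc n) + a + b) * (real n + a + b) * poly (pderiv (pderiv (diag_poly a b p (Suc (Suc n))))) 1
     = 2 * (real n + b) * ((real n + a + b) * poly (pderiv ?F) 1)
       + (real n + a + b) * (real n - 1 + a + b) * poly (pderiv (pderiv ?F)) 1"
    by (simp only: mult.assoc mult.left_commute[of "real (Suc n) + a + b"]) (simp only: distrib_left mult_ac)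
  then show ?case unfolding Suc.IH diag_poly_first_moment[OF ab]
    by (simp only: of_nat_Suc) (simp add: field_simps power2_eq_square)
qed

definition mean_value :: "real \<Rightarrow> real \<Rightarrow> real \<Rightarrow> nat \<Rightarrow> real" where
  "mean_value a b p n = poly (pderiv (diag_poly a b p n)) 1"

definition var_value :: "real \<Rightarrow> real \<Rightarrow> real \<Rightarrow> nat \<Rightarrow> real" where
  "var_value a b p n = poly (pderiv (pderiv (diag_poly a b p n))) 1 + mean_value a b p n - (mean_value a b p n)\<^sup>2"

lemma mean_value_asymp:
  assumes ab: "a \<ge> 0" "b \<ge> 0" "(a + b) * p = b"
  shows "(\<lambda>n. (mean_value a b p n - real n / 2) / sqrt (real n)) \<longlonglongrightarrow> 0"
proof (rule Lim_transform_eventually)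
  show "(\<lambda>n. ((real n * (real n - 1) / 2 + real n * b) / (real n - 1 + a + b) - real n / 2) / sqrt (real n)) \<longlonglongrightarrow> 0"
    by real_asymp
  show "\<forall>\<^sub>F n in sequentially. ((real n * (real n - 1) / 2 + real n * b) / (real n - 1 + a + b) - real n / 2) / sqrt (real n)
     = (mean_value a b p n - real n / 2) / sqrt (real n)"
    using eventually_gt_at_top[of 2]
  proof eventually_elim
    case (elim n)
    then have "mean_value a b p n = (real n * (real n - 1) / 2 + real n * b) / (real n - 1 + a + b)"
      using diag_poly_first_moment[OF ab, of "n - 1"] ab
      by (intro eq_divide_imp) (auto simp: mean_value_def of_nat_diff mult.commute)
    then show ?case by simp
  qed
qed

text \<open>In the variance the terms of order \<open>n\<^sup>2\<close> cancel, so that its growth can only be read off from the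
  fully expanded numerator.\<close>

lemma var_value_eq:
  fixes a b p :: real and n :: nat
  assumes ab: "a \<ge> 0" "b \<ge> 0" "(a + b) * p = b" and n: "n > 2"
  defines "c \<equiv> a + b" and "s \<equiv> real n - 1 + a + b"
  shows "var_value a b p n = real n * (real n ^ 3 / 12 + (c - 1) / 3 * (real n)\<^sup>2
      + (5 / 12 - c + c\<^sup>2 / 2) * real n
      + (b\<^sup>2 * (1 - c) + b * c * (c - 1) - c\<^sup>2 / 2 + 2 / 3 * c - 1 / 6)) / (s\<^sup>2 * (s - 1))"
proof -
  define N where "N = real n"
  define m where "m = mean_value a b p n"
  define f where "f = poly (pderiv (pderiv (diag_poly a b p n))) 1"
  have s: "s > 0" "s - 1 > 0" using n ab(1,2) by (auto simp: s_def)
  have c: "c = s - N + 1" by (simp add: c_def s_def N_def)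
  have Suc: "Suc (n - 1) = n" and N1: "real (n - 1) = N - 1"
    using n by (simp_all add: N_def of_nat_diff)
  have m: "s * m = N * (N - 1) / 2 + N * b"
    using diag_poly_first_moment[OF ab, of "n - 1"] unfolding Suc N1
    by (simp add: s_def m_def mean_value_def N_def)
  have f: "s * (s - 1) * f = N * (N - 1) * (N - 2) * (N - 3) / 4
        + (1 / 3 + b) * (N * (N - 1) * (N - 2)) + b\<^sup>2 * (N * (N - 1))"
    using diag_poly_second_moment[OF ab, of "n - 1"] unfolding Suc N1
    by (simp add: s_def f_def N_def algebra_simps)
  \<comment> \<open>the right-hand side involves \<open>m\<close> and \<open>f\<close> only through the known products \<open>s m\<close> and \<open>s (s - 1) f\<close>\<close>
  have "(f + m - m\<^sup>2) * (s\<^sup>2 * (s - 1)) = s * (s * (s - 1) * f) + s * (s - 1) * (s * m) - (s - 1) * (s * m)\<^sup>2"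
    by (simp add: power2_eq_square algebra_simps)
  also have "\<dots> = N * (N ^ 3 / 12 + (c - 1) / 3 * N\<^sup>2 + (5 / 12 - c + c\<^sup>2 / 2) * N
      + (b\<^sup>2 * (1 - c) + b * c * (c - 1) - c\<^sup>2 / 2 + 2 / 3 * c - 1 / 6))"
    unfolding f m c by (simp add: field_simps power2_eq_square power3_eq_cube)
  finally show ?thesis
    using s by (simp add: var_value_def f_def m_def N_def eq_divide_eq)
qed

lemma var_value_asymp:
  assumes ab: "a \<ge> 0" "b \<ge> 0" "(a + b) * p = b"
  shows "(\<lambda>n. var_value a b p n / real n) \<longlonglongrightarrow> 1 / 12"
proof (rule Lim_transform_eventually)
  define c where "c = a + b"
  define k1 where "k1 = (c - 1) / 3"
  define k2 where "k2 = 5 / 12 - c + c\<^sup>2 / 2"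
  define k3 where "k3 = b\<^sup>2 * (1 - c) + b * c * (c - 1) - c\<^sup>2 / 2 + 2 / 3 * c - 1 / 6"
  let ?V = "\<lambda>n. (real n ^ 3 / 12 + k1 * (real n)\<^sup>2 + k2 * real n + k3)
      / ((real n - 1 + a + b)\<^sup>2 * (real n - 1 + a + b - 1))"
  show "?V \<longlonglongrightarrow> 1 / 12"
    by real_asymp
  show "\<forall>\<^sub>F n in sequentially. ?V n = var_value a b p n / real n"
    using eventually_gt_at_top[of 2]
  proof eventually_elim
    case (elim n)
    then show ?case unfolding var_value_eq[OF ab elim] c_def k1_def k2_def k3_def by simp
  qed
qed

lemma bernoulli_prod_moments:
  "poly (bernoulli_prod qs) 1 = 1"
  "poly (pderiv (bernoulli_prod qs)) 1 = sum_list qs"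
  "poly (pderiv (pderiv (bernoulli_prod qs))) 1 + sum_list qs - (sum_list qs)\<^sup>2 = (\<Sum>q\<leftarrow>qs. q * (1 - q))"
proof -
  show 0: "poly (bernoulli_prod qs) 1 = 1" for qs by (induction qs) simp_all
  show 1: "poly (pderiv (bernoulli_prod qs)) 1 = sum_list qs" for qs
  proof (induction qs)
    case (Cons q qs)
    then show ?case
      unfolding bernoulli_prod_simps pderiv_mult using 0[of qs] by (simp add: pderiv_pCons algebra_simps)
  qed simp
  show "poly (pderiv (pderiv (bernoulli_prod qs))) 1 + sum_list qs - (sum_list qs)\<^sup>2 = (\<Sum>q\<leftarrow>qs. q * (1 - q))"
  proof (induction qs)
    case (Cons q qs)
    have "poly (pderiv (pderiv (bernoulli_prod (q # qs)))) 1
      = 2 * q * sum_list qs + poly (pderiv (pderiv (bernoulli_prod qs))) 1"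
      unfolding bernoulli_prod_simps pderiv_mult pderiv_add poly_add
      using 0[of qs] 1[of qs] by (simp add: pderiv_pCons algebra_simps)
    then show ?case using Cons by (simp add: power2_eq_square algebra_simps)
  qed simp
qed

section \<open>The law of the number of diagonal symbols\<close>

lemma eulerian_poly_eq_diag_poly:
  assumes "a > 0" "b > 0"
  shows "eulerian_poly a b n = smult (\<Prod>j<n. real j + a + b) (diag_poly a b (b / (a + b)) n)"
proof (induction n)
  case (Suc n)
  show ?case
  proof (cases "n = 0")
    case True
    then show ?thesis using assms by (simp add: field_simps)
  next
    case False
    let ?c = "\<Prod>j<n. real j + a + b" and ?F = "diag_poly a b (b / (a + b)) n"
    have "eulerian_poly a b (Suc n) = smult ?c ([:a, real n + b:] * ?F + [:0, 1, -1:] * pderiv ?F)"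
      by (simp only: eulerian_poly.simps Suc.IH pderiv_smult mult_smult_right smult_add_right)
    also have "\<dots> = smult (?c * (real n + a + b)) (diag_poly a b (b / (a + b)) (Suc n))"
      using False assms by (simp only: diag_poly.simps if_False smult_smult) simp
    finally show ?thesis by (simp only: prod.lessThan_Suc)
  qed
qed simp

text \<open>Both sides are proportional and have the value \<open>1\<close> at \<open>1\<close>.\<close>

lemma tableau_prob_fin_poly:
  assumes "\<alpha> > 0" "\<beta> > 0"
  shows "(\<Sum>S\<in>staircase_tableaux n. monom (tableau_prob_fin n \<alpha> \<beta> S) (diag_alphas n S))
     = diag_poly (1 / \<alpha>) (1 / \<beta>) (1 / \<beta> / (1 / \<alpha> + 1 / \<beta>)) n" (is "?L = ?F")
proof -
  have "tableau_poly n \<alpha> \<beta> 1 = smult (partition_fun n \<alpha> \<beta>) ?L"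
    using partition_fun_pos[OF assms, of n]
    by (simp add: tableau_poly_def tableau_prob_fin_def smult_sum_right smult_monom)
  then have "smult (partition_fun n \<alpha> \<beta>) ?L = smult ((\<alpha> * \<beta>) ^ n) (eulerian_poly (1 / \<alpha>) (1 / \<beta>) n)"
    by (simp only: tableau_poly_eq_eulerian_poly[OF assms])
  also have "eulerian_poly (1 / \<alpha>) (1 / \<beta>) n = smult (\<Prod>j<n. real j + 1 / \<alpha> + 1 / \<beta>) ?F"
    using assms by (intro eulerian_poly_eq_diag_poly) simp_all
  finally have c: "smult (partition_fun n \<alpha> \<beta>) ?L
      = smult ((\<alpha> * \<beta>) ^ n * (\<Prod>j<n. real j + 1 / \<alpha> + 1 / \<beta>)) ?F" (is "_ = smult ?c _")
    by (simp only: smult_smult)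
  have "poly ?L 1 = 1"
    using sum_tableau_prob_fin[OF assms, of n] by (simp add: poly_sum poly_monom)
  moreover have "poly ?F 1 = 1" using assms by (intro poly_diag_poly_1) simp_all
  ultimately have "?c = partition_fun n \<alpha> \<beta>"
    using arg_cong[OF c, of "\<lambda>p. poly p 1"] by (simp only: poly_smult mult_1_right)
  from c[unfolded this] partition_fun_pos[OF assms, of n] show ?thesis
    using smult_cancel[of "partition_fun n \<alpha> \<beta>" ?L ?F] by simp
qed

lemma tendsto_coeff_diag_poly:
  assumes "(A \<longlongrightarrow> a) F" "(B \<longlongrightarrow> b) F" "(P \<longlongrightarrow> p) F" "a \<ge> 0" "b \<ge> 0"
  shows "((\<lambda>t. coeff (diag_poly (A t) (B t) (P t) n) k) \<longlongrightarrow> coeff (diag_poly a b p n) k) F"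
proof (induction n arbitrary: k)
  case (Suc n)
  show ?case
  proof (cases "n = 0")
    case True
    then show ?thesis using assms by (auto simp: coeff_pCons split: nat.splits intro!: tendsto_intros)
  next
    case False
    have "real n + a + b \<noteq> 0" using False assms(4,5) by linarith
    then show ?thesis
      using False assms(1-3) Suc unfolding diag_poly.simps coeff_smult coeff_euler_step if_False
      by (cases "k = 0") (auto simp only: if_True if_False simp_thms coeff_smult coeff_euler_step intro!: tendsto_intros)
  qed
qed simp

text \<open>For infinite parameters the law is a limit of laws with finite parameters, and the coefficients
  converge. With two infinite parameters, which grow at the same rate, the limit of \<open>p\<close> is \<open>1 / 2\<close>;
  otherwise it is \<open>b / (a + b)\<close>.\<close>

lemma tableau_prob_poly:
  assumes "\<alpha> > 0" "\<beta> > 0"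
  obtains a b p where "a \<ge> 0" "b \<ge> 0" "0 \<le> p" "p \<le> 1" "(a + b) * p = b"
    "\<And>n. (\<Sum>S\<in>staircase_tableaux n. monom (tableau_prob n \<alpha> \<beta> S) (diag_alphas n S)) = diag_poly a b p n"
proof -
  have pos: "enn2real x > 0" if "x > 0" "x \<noteq> \<infinity>" for x
    using that by (simp add: enn2real_positive_iff top.not_eq_extremum)
  define A where "A t = (if \<alpha> = \<infinity> then t else enn2real \<alpha>)" for t
  define B where "B t = (if \<beta> = \<infinity> then t else enn2real \<beta>)" for t
  define a where "a = (if \<alpha> = \<infinity> then 0 else 1 / enn2real \<alpha>)"
  define b where "b = (if \<beta> = \<infinity> then 0 else 1 / enn2real \<beta>)"
  define p where "p = (if \<alpha> = \<infinity> \<and> \<beta> = \<infinity> then 1 / 2 else b / (a + b))"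
  have ab: "a \<ge> 0" "b \<ge> 0" by (simp_all add: a_def b_def)
  have ab0: "a + b > 0" if "\<not> (\<alpha> = \<infinity> \<and> \<beta> = \<infinity>)"
    using that pos[OF assms(1)] pos[OF assms(2)] by (auto simp: a_def b_def add_pos_nonneg add_nonneg_pos)
  have inv: "((\<lambda>t::real. 1 / t) \<longlongrightarrow> 0) at_top" by real_asymp
  have lima: "((\<lambda>t. 1 / A t) \<longlongrightarrow> a) at_top" using inv by (auto simp: A_def a_def)
  have limb: "((\<lambda>t. 1 / B t) \<longlongrightarrow> b) at_top" using inv by (auto simp: B_def b_def)
  have limp: "((\<lambda>t. 1 / B t / (1 / A t + 1 / B t)) \<longlongrightarrow> p) at_top"
  proof (cases "\<alpha> = \<infinity> \<and> \<beta> = \<infinity>")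
    case True
    have "\<forall>\<^sub>F t::real in at_top. 1 / t / (1 / t + 1 / t) = 1 / 2"
      using eventually_gt_at_top[of 0] by eventually_elim (simp add: field_simps)
    then show ?thesis using True by (simp add: A_def B_def p_def tendsto_eventually)
  next
    case False
    then have "p = b / (a + b)" by (auto simp: p_def)
    then show ?thesis using ab0[OF False] tendsto_divide[OF limb tendsto_add[OF lima limb]] by simp
  qed
  have law: "(\<Sum>S\<in>staircase_tableaux n. monom (tableau_prob n \<alpha> \<beta> S) (diag_alphas n S)) = diag_poly a b p n" for n
  proof (rule poly_eqI)
    fix k
    let ?c = "\<lambda>w. coeff (\<Sum>S\<in>staircase_tableaux n. monom (w S) (diag_alphas n S)) k"
    have "((\<lambda>t. ?c (tableau_prob_fin n (A t) (B t))) \<longlongrightarrow> ?c (tableau_prob n \<alpha> \<beta>)) at_top"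
    proof -
      have "((\<lambda>t. tableau_prob_fin n (A t) (B t) S) \<longlongrightarrow> tableau_prob n \<alpha> \<beta> S) at_top" for S
        unfolding A_def B_def by (rule tableau_prob_limit[OF assms])
      then show ?thesis
        unfolding coeff_sum coeff_monom by (intro tendsto_sum) (auto intro: tendsto_const)
    qed
    moreover have "\<forall>\<^sub>F t in at_top. ?c (tableau_prob_fin n (A t) (B t))
        = coeff (diag_poly (1 / A t) (1 / B t) (1 / B t / (1 / A t + 1 / B t)) n) k"
      using eventually_gt_at_top[of 0]
    proof eventually_elim
      case (elim t)
      have "A t > 0" "B t > 0" using elim pos assms by (auto simp: A_def B_def)
      then show ?case by (simp only: tableau_prob_fin_poly)
    qed
    ultimately have "((\<lambda>t. coeff (diag_poly (1 / A t) (1 / B t) (1 / B t / (1 / A t + 1 / B t)) n) k)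
        \<longlongrightarrow> ?c (tableau_prob n \<alpha> \<beta>)) at_top"
      by (rule Lim_transform_eventually)
    moreover have "((\<lambda>t. coeff (diag_poly (1 / A t) (1 / B t) (1 / B t / (1 / A t + 1 / B t)) n) k)
        \<longlongrightarrow> coeff (diag_poly a b p n) k) at_top"
      by (intro tendsto_coeff_diag_poly lima limb limp ab)
    ultimately show "?c (tableau_prob n \<alpha> \<beta>) = coeff (diag_poly a b p n) k"
      using tendsto_unique[OF trivial_limit_at_top_linorder] by blast
  qed
  have p: "0 \<le> p" "p \<le> 1" using ab by (auto simp: p_def divide_le_eq_1)
  have "(a + b) * p = b"
  proof (cases "\<alpha> = \<infinity> \<and> \<beta> = \<infinity>")
    case True
    then show ?thesis by (simp add: a_def b_def)
  next
    case False
    then show ?thesis using ab0[OF False] by (auto simp: p_def)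
  qed
  from that[OF ab p this law] show ?thesis .
qed

lemma set_pmf_random_tableau:
  assumes "\<alpha> > 0" "\<beta> > 0"
  shows "set_pmf (random_tableau n \<alpha> \<beta>) \<subseteq> staircase_tableaux n"
proof
  fix S assume "S \<in> set_pmf (random_tableau n \<alpha> \<beta>)"
  then have "pmf (random_tableau n \<alpha> \<beta>) S \<noteq> 0" by (rule pmf_positive[THEN less_imp_neq, symmetric])
  then have nz: "tableau_prob n \<alpha> \<beta> S \<noteq> 0" unfolding pmf_random_tableau[OF assms] .
  show "S \<in> staircase_tableaux n"
  proof (rule ccontr)
    assume "S \<notin> staircase_tableaux n"
    then have "((\<lambda>t::real. 0) \<longlongrightarrow> tableau_prob n \<alpha> \<beta> S) at_top"
      using tableau_prob_limit[OF assms, of n S] by (simp add: tableau_prob_fin_def)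
    from tendsto_unique[OF trivial_limit_at_top_linorder this tendsto_const] nz show False by simp
  qed
qed

lemma expectation_random_tableau:
  fixes f :: "nat \<Rightarrow> real"
  assumes "\<alpha> > 0" "\<beta> > 0"
  shows "measure_pmf.expectation (random_tableau n \<alpha> \<beta>) (\<lambda>S. f (diag_alphas n S))
    = (\<Sum>S\<in>staircase_tableaux n. tableau_prob n \<alpha> \<beta> S * f (diag_alphas n S))"
  using set_pmf_random_tableau[OF assms, of n]
  by (subst integral_measure_pmf[OF finite_staircase_tableaux[of n]])
    (auto simp: pmf_random_tableau[OF assms])

lemma pmf_diag_alphas:
  assumes "\<alpha> > 0" "\<beta> > 0"
    "(\<Sum>S\<in>staircase_tableaux n. monom (tableau_prob n \<alpha> \<beta> S) (diag_alphas n S)) = F"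
  shows "pmf (map_pmf (diag_alphas n) (random_tableau n \<alpha> \<beta>)) k = coeff F k"
proof -
  have "pmf (map_pmf (diag_alphas n) (random_tableau n \<alpha> \<beta>)) k
      = measure_pmf.expectation (random_tableau n \<alpha> \<beta>) (\<lambda>S. indicator {k} (diag_alphas n S))"
  proof -
    have "(\<lambda>S. indicator {k} (diag_alphas n S) :: real) = indicator (diag_alphas n -` {k})"
      by (auto simp: indicator_def fun_eq_iff)
    then show ?thesis by (simp add: pmf_map)
  qed
  also have "\<dots> = coeff F k"
    unfolding expectation_random_tableau[OF assms(1,2)] assms(3)[symmetric]
    by (auto simp: coeff_sum indicator_def intro!: sum.cong)
  finally show ?thesis .
qed

lemma pderiv_sum_family: "pderiv (\<Sum>i\<in>A. f i) = (\<Sum>i\<in>A. pderiv (f i))"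
  by (induction A rule: infinite_finite_induct) (simp_all add: pderiv_add)

text \<open>Mean and second factorial moment are the first two derivatives of the probability generating
  function at \<open>1\<close>.\<close>

lemma mean_var_A_eq:
  assumes "\<alpha> > 0" "\<beta> > 0"
    "(\<Sum>S\<in>staircase_tableaux n. monom (tableau_prob n \<alpha> \<beta> S) (diag_alphas n S)) = F"
  shows "mean_A n \<alpha> \<beta> = poly (pderiv F) 1"
    and "var_A n \<alpha> \<beta> = poly (pderiv (pderiv F)) 1 + poly (pderiv F) 1 - (poly (pderiv F) 1)\<^sup>2"
proof -
  let ?M = "random_tableau n \<alpha> \<beta>" and ?X = "\<lambda>S. real (diag_alphas n S)"
  have int: "integrable (measure_pmf ?M) f" for f :: "filling \<Rightarrow> real"
    using set_pmf_random_tableau[OF assms(1,2), of n] finite_staircase_tableaux[of n]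
    by (intro integrable_measure_pmf_finite) (rule finite_subset)
  have d1: "poly (pderiv F) 1 = (\<Sum>S\<in>staircase_tableaux n. tableau_prob n \<alpha> \<beta> S * ?X S)"
    unfolding assms(3)[symmetric] pderiv_sum_family pderiv_monom poly_sum poly_monom by (simp add: mult.commute)
  have d2: "poly (pderiv (pderiv F)) 1
     = (\<Sum>S\<in>staircase_tableaux n. tableau_prob n \<alpha> \<beta> S * (?X S * (?X S - 1)))"
    unfolding assms(3)[symmetric] pderiv_sum_family pderiv_monom poly_sum poly_monom
    by (intro sum.cong refl) (auto simp: of_nat_diff Suc_le_eq)
  show mean: "mean_A n \<alpha> \<beta> = poly (pderiv F) 1"
    unfolding mean_A_def expectation_random_tableau[OF assms(1,2), of _ real] d1 ..
  have "var_A n \<alpha> \<beta> = measure_pmf.expectation ?M (\<lambda>S. (?X S)\<^sup>2) - (mean_A n \<alpha> \<beta>)\<^sup>2"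
    unfolding var_A_def mean_A_def by (rule measure_pmf.variance_eq[OF int int])
  also have "measure_pmf.expectation ?M (\<lambda>S. (?X S)\<^sup>2) = poly (pderiv (pderiv F)) 1 + poly (pderiv F) 1"
    unfolding expectation_random_tableau[OF assms(1,2), of _ "\<lambda>k. (real k)\<^sup>2"] d1 d2 sum.distrib[symmetric]
    by (simp add: algebra_simps power2_eq_square)
  finally show "var_A n \<alpha> \<beta> = poly (pderiv (pderiv F)) 1 + poly (pderiv F) 1 - (poly (pderiv F) 1)\<^sup>2"
    by (simp only: mean)
qed

section \<open>Characteristic functions of sums of independent Bernoulli variables\<close>

text \<open>The constant is not optimal. It comes from
  \<open>1 - cos 4v = 8 sin\<^sup>2v cos\<^sup>2v\<close>, since for \<open>|v| \<le> \<pi> / 4\<close> both \<open>cos\<^sup>2v \<ge> 1 / 2\<close> and \<open>|sin v| \<ge> 5|v| / 6\<close>.\<close>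

lemma one_minus_cos_ge:
  fixes u :: real
  assumes "\<bar>u\<bar> \<le> pi"
  shows "u\<^sup>2 / 12 \<le> 1 - cos u"
proof -
  define v where "v = u / 4"
  have v: "\<bar>v\<bar> \<le> pi / 4" "\<bar>v\<bar> \<le> 1" using assms pi_less_4 by (auto simp: v_def)
  have "cos (2 * v) \<ge> 0" using v(1) by (intro cos_ge_zero) auto
  then have cos: "(cos v)\<^sup>2 \<ge> 1 / 2" by (simp add: cos_double_cos)
  have "\<bar>sin v - v\<bar> \<le> \<bar>v\<bar> ^ 3 / 6"
    using Maclaurin_sin_bound[of v 3] by (simp add: eval_nat_numeral sin_coeff_def)
  also have "\<bar>v\<bar> ^ 3 \<le> \<bar>v\<bar> * 1"
    unfolding power3_eq_cube using v(2) by (metis abs_ge_zero mult.assoc mult_le_one mult_left_mono)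
  finally have "5 / 6 * \<bar>v\<bar> \<le> \<bar>sin v\<bar>" by linarith
  then have "(5 / 6 * \<bar>v\<bar>)\<^sup>2 \<le> \<bar>sin v\<bar>\<^sup>2" by (intro power_mono) auto
  then have sin: "25 / 36 * v\<^sup>2 \<le> (sin v)\<^sup>2" by (simp add: power_mult_distrib power_divide)
  have "1 - cos u = 1 - cos (2 * (2 * v))" by (simp add: v_def)
  also have "\<dots> = 8 * (sin v)\<^sup>2 * (cos v)\<^sup>2"
    unfolding cos_double_sin[of "2 * v"] by (simp add: sin_double power_mult_distrib)
  also have "\<dots> \<ge> 8 * (25 / 36 * v\<^sup>2) * (1 / 2)" using sin cos by (intro mult_mono) auto
  finally have "1 - cos u \<ge> 25 / 9 * v\<^sup>2" by simp
  moreover have "u\<^sup>2 = 16 * v\<^sup>2" by (simp add: v_def power_divide)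
  ultimately show ?thesis using zero_le_power2[of v] by linarith
qed

definition bernoulli_char :: "real list \<Rightarrow> real \<Rightarrow> complex" where
  "bernoulli_char qs u = (\<Prod>q\<leftarrow>qs. 1 - of_real q + of_real q * iexp u)"

text \<open>The square of the modulus is exactly \<open>1 - 2 q (1 - q) (1 - cos u)\<close>.\<close>

lemma norm_bernoulli_factor_le:
  assumes "0 \<le> q" "q \<le> 1"
  shows "cmod (1 - of_real q + of_real q * iexp u) \<le> exp (- (q * (1 - q) * (1 - cos u)))"
proof -
  let ?z = "1 - of_real q + of_real q * iexp u"
  have Re: "Re ?z = 1 - q + q * cos u" and Im: "Im ?z = q * sin u"
    by (simp_all add: Re_exp Im_exp)
  have "(cmod ?z)\<^sup>2 = (1 - q + q * cos u)\<^sup>2 + (q * sin u)\<^sup>2"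
    unfolding cmod_power2 Re Im ..
  also have "(q * sin u)\<^sup>2 = q\<^sup>2 - (q * cos u)\<^sup>2"
    by (simp add: power_mult_distrib sin_squared_eq right_diff_distrib)
  also have "(1 - q + q * cos u)\<^sup>2 + (q\<^sup>2 - (q * cos u)\<^sup>2) = 1 + 2 * (- (q * (1 - q) * (1 - cos u)))"
    by (simp add: power2_eq_square algebra_simps)
  also have "\<dots> \<le> exp (2 * (- (q * (1 - q) * (1 - cos u))))"
    by (rule exp_ge_add_one_self)
  also have "\<dots> = (exp (- (q * (1 - q) * (1 - cos u))))\<^sup>2" by (rule exp_double)
  finally show ?thesis by (rule power2_le_imp_le) simp
qed

lemma norm_bernoulli_char_le:
  assumes "set qs \<subseteq> {0..1}"
  shows "cmod (bernoulli_char qs u) \<le> exp (- ((\<Sum>q\<leftarrow>qs. q * (1 - q)) * (1 - cos u)))"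
  using assms
proof (induction qs)
  case (Cons q qs)
  have "cmod (bernoulli_char (q # qs) u) = cmod (1 - of_real q + of_real q * iexp u) * cmod (bernoulli_char qs u)"
    by (simp only: bernoulli_char_def list.map prod_list.Cons norm_mult)
  also have "\<dots> \<le> exp (- (q * (1 - q) * (1 - cos u))) * exp (- ((\<Sum>q\<leftarrow>qs. q * (1 - q)) * (1 - cos u)))"
    using Cons by (intro mult_mono norm_bernoulli_factor_le) auto
  also have "\<dots> = exp (- ((\<Sum>q\<leftarrow>q # qs. q * (1 - q)) * (1 - cos u)))"
    by (simp add: algebra_simps flip: exp_add)
  finally show ?case .
qed (simp add: bernoulli_char_def)

text \<open>The first term is \<open>E (exp (i v (B - q)))\<close> for a Bernoulli variable \<open>B\<close>. Both terms agree with
  \<open>1 - q (1 - q) v\<^sup>2 / 2\<close> up to terms of third order in \<open>v\<close>, and every error carries the factor \<open>q (1 - q)\<close>, so that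
  the errors of many factors add up to a multiple of the variance.\<close>

lemma centred_bernoulli_factor:
  assumes "0 \<le> q" "q \<le> 1"
  shows "cmod (iexp (- (q * v)) * (1 - of_real q + of_real q * iexp v) - of_real (exp (- (q * (1 - q) * v\<^sup>2 / 2))))
     \<le> q * (1 - q) * (\<bar>v\<bar> ^ 3 + v ^ 4)"
proof -
  define x where "x = q * (1 - q) * v\<^sup>2 / 2"
  have q01: "q * (1 - q) \<ge> 0" "q * (1 - q) \<le> 1" using assms by (auto intro: mult_le_one)
  have x0: "x \<ge> 0" using q01 by (simp add: x_def)
  define T where "T y = 1 + \<i> * of_real y - of_real (y\<^sup>2 / 2)" for y :: real
  have T: "cmod (iexp y - T y) \<le> \<bar>y\<bar> ^ 3 / 6" for y
    using iexp_approx1[of y 2] by (simp add: T_def eval_nat_numeral algebra_simps power2_eq_square)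
  have e: "iexp (- (q * v)) * iexp v = iexp ((1 - q) * v)"
    by (simp add: algebra_simps flip: exp_add)
  have eq1: "iexp (- (q * v)) * (1 - of_real q + of_real q * iexp v)
      = of_real (1 - q) * iexp (- (q * v)) + of_real q * iexp ((1 - q) * v)"
    unfolding e[symmetric] by (simp add: algebra_simps)
  have eq2: "of_real (1 - q) * T (- (q * v)) + of_real q * T ((1 - q) * v) = 1 - of_real x"
    by (simp add: T_def x_def complex_eq_iff field_simps power2_eq_square)
  have "cmod (iexp (- (q * v)) * (1 - of_real q + of_real q * iexp v) - (1 - of_real x))
     = cmod (of_real (1 - q) * (iexp (- (q * v)) - T (- (q * v))) + of_real q * (iexp ((1 - q) * v) - T ((1 - q) * v)))"
    unfolding eq1 eq2[symmetric] by (simp add: algebra_simps)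
  also have "\<dots> \<le> (1 - q) * (\<bar>- (q * v)\<bar> ^ 3 / 6) + q * (\<bar>(1 - q) * v\<bar> ^ 3 / 6)"
  proof (rule order_trans[OF norm_triangle_ineq add_mono])
    have n: "cmod (of_real (1 - q)) = 1 - q" "cmod (of_real q) = q"
      using assms unfolding norm_of_real by simp_all
    show "cmod (of_real (1 - q) * (iexp (- (q * v)) - T (- (q * v)))) \<le> (1 - q) * (\<bar>- (q * v)\<bar> ^ 3 / 6)"
      unfolding norm_mult n by (rule mult_left_mono[OF T]) (use assms in simp)
    show "cmod (of_real q * (iexp ((1 - q) * v) - T ((1 - q) * v))) \<le> q * (\<bar>(1 - q) * v\<bar> ^ 3 / 6)"
      unfolding norm_mult n by (rule mult_left_mono[OF T]) (use assms in simp)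
  qed
  also have "\<dots> = q * (1 - q) * \<bar>v\<bar> ^ 3 * ((q\<^sup>2 + (1 - q)\<^sup>2) / 6)"
  proof -
    have abs: "\<bar>- (q * v)\<bar> = q * \<bar>v\<bar>" "\<bar>(1 - q) * v\<bar> = (1 - q) * \<bar>v\<bar>"
      using assms unfolding abs_minus_cancel abs_mult by simp_all
    show ?thesis unfolding abs by (simp add: power2_eq_square power3_eq_cube field_simps)
  qed
  also have "\<dots> \<le> q * (1 - q) * \<bar>v\<bar> ^ 3 * 1"
  proof (intro mult_left_mono)
    have "q\<^sup>2 \<le> 1" "(1 - q)\<^sup>2 \<le> 1" using assms by (auto simp: power_le_one)
    then show "(q\<^sup>2 + (1 - q)\<^sup>2) / 6 \<le> 1" by simp
    show "0 \<le> q * (1 - q) * \<bar>v\<bar> ^ 3" using q01 by simp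
  qed
  finally have 1: "cmod (iexp (- (q * v)) * (1 - of_real q + of_real q * iexp v) - (1 - of_real x))
     \<le> q * (1 - q) * \<bar>v\<bar> ^ 3" by simp
  have "1 - x \<le> exp (- x)" using exp_ge_add_one_self[of "- x"] by simp
  moreover have "exp (- x) \<le> 1 - x + x\<^sup>2"
  proof (cases "x \<le> 1")
    case True
    have "exp (- x) * (1 + x) \<le> exp (- x) * exp x"
      by (intro mult_left_mono exp_ge_add_one_self) auto
    then have "exp (- x) * (1 + x) \<le> 1" by (simp flip: exp_add)
    also have "1 \<le> (1 - x + x\<^sup>2) * (1 + x)"
      using x0 by (simp add: power2_eq_square algebra_simps)
    finally show ?thesis using x0 by simp
  next
    case False
    then have "x\<^sup>2 \<ge> x" by (simp add: power2_eq_square)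
    moreover have "exp (- x) \<le> 1" using x0 by simp
    ultimately show ?thesis by linarith
  qed
  ultimately have "\<bar>(1 - x) - exp (- x)\<bar> \<le> x\<^sup>2" by linarith
  also have "x\<^sup>2 = (q * (1 - q)) * (q * (1 - q)) * v ^ 4 / 4"
    by (simp add: x_def power2_eq_square eval_nat_numeral)
  also have "\<dots> \<le> (q * (1 - q)) * 1 * v ^ 4 / 4"
    using q01 by (intro divide_right_mono mult_right_mono mult_left_mono) auto
  also have "\<dots> \<le> q * (1 - q) * v ^ 4"
  proof -
    have "0 \<le> q * (1 - q) * v ^ 4" by (intro mult_nonneg_nonneg[OF q01(1)]) simp
    then show ?thesis unfolding mult_1_right by linarith
  qed
  finally have "\<bar>(1 - x) - exp (- x)\<bar> \<le> q * (1 - q) * v ^ 4" .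
  moreover have "(1 - of_real x) - of_real (exp (- x)) = complex_of_real ((1 - x) - exp (- x))" by simp
  ultimately have 2: "cmod ((1 - of_real x) - of_real (exp (- x))) \<le> q * (1 - q) * v ^ 4"
    by (simp only: norm_of_real)
  from norm_diff_triangle_le[OF 1 2] show ?thesis
    unfolding x_def distrib_left .
qed

text \<open>All factors have modulus at most \<open>1\<close>, hence the errors of the single factors add up.\<close>

lemma centred_bernoulli_char:
  assumes "set qs \<subseteq> {0..1}"
  shows "cmod (iexp (- (sum_list qs * v)) * bernoulli_char qs v - of_real (exp (- ((\<Sum>q\<leftarrow>qs. q * (1 - q)) * v\<^sup>2 / 2))))
     \<le> (\<Sum>q\<leftarrow>qs. q * (1 - q)) * (\<bar>v\<bar> ^ 3 + v ^ 4)"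
  using assms
proof (induction qs)
  case Nil
  then show ?case by (simp add: bernoulli_char_def)
next
  case (Cons q qs)
  let ?V = "\<Sum>q\<leftarrow>qs. q * (1 - q)"
  define z where "z = iexp (- (q * v)) * (1 - of_real q + of_real q * iexp v)"
  define w where "w = complex_of_real (exp (- (q * (1 - q) * v\<^sup>2 / 2)))"
  define Z where "Z = iexp (- (sum_list qs * v)) * bernoulli_char qs v"
  define W where "W = complex_of_real (exp (- (?V * v\<^sup>2 / 2)))"
  have q: "0 \<le> q" "q \<le> 1" using Cons.prems by auto
  have "0 \<le> x \<and> x \<le> 1" if "x \<in> set qs" for x using Cons.prems that by (simp add: subset_iff)
  then have V: "?V \<ge> 0" by (intro sum_list_nonneg) auto
  have "cmod z \<le> exp (- (q * (1 - q) * (1 - cos v)))"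
    unfolding z_def norm_mult norm_exp_i_times using norm_bernoulli_factor_le[OF q] by simp
  also have "\<dots> \<le> 1" using q by simp
  finally have z: "cmod z \<le> 1" .
  have W: "cmod W \<le> 1" using V by (simp add: W_def)
  have zZ: "iexp (- (sum_list (q # qs) * v)) * bernoulli_char (q # qs) v = z * Z"
  proof -
    have "iexp (- (sum_list (q # qs) * v)) = iexp (- (q * v)) * iexp (- (sum_list qs * v))"
      by (simp add: algebra_simps flip: exp_add)
    then show ?thesis
      unfolding z_def Z_def bernoulli_char_def list.map prod_list.Cons by (simp only: mult_ac)
  qed
  have wW: "of_real (exp (- ((\<Sum>q\<leftarrow>q # qs. q * (1 - q)) * v\<^sup>2 / 2))) = w * W"
    unfolding w_def W_def of_real_mult[symmetric] exp_add[symmetric] by (simp add: field_simps)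
  have "cmod (z * Z - w * W) = cmod (z * (Z - W) + (z - w) * W)" by (simp add: algebra_simps)
  also have "\<dots> \<le> cmod z * cmod (Z - W) + cmod (z - w) * cmod W"
    by (rule order_trans[OF norm_triangle_ineq]) (simp add: norm_mult)
  also have "\<dots> \<le> 1 * cmod (Z - W) + cmod (z - w) * 1"
    using z W by (intro add_mono mult_mono) auto
  also have "\<dots> \<le> ?V * (\<bar>v\<bar> ^ 3 + v ^ 4) + q * (1 - q) * (\<bar>v\<bar> ^ 3 + v ^ 4)"
    using Cons.IH Cons.prems centred_bernoulli_factor[OF q, of v]
    by (intro add_mono) (simp_all add: Z_def W_def z_def w_def)
  finally show ?case unfolding zZ wW by (simp add: algebra_simps)
qed

section \<open>Central and local limit theorems for Bernoulli sums\<close>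

lemma char_normal:
  assumes "\<sigma> > 0"
  shows "char (density lborel (normal_density 0 \<sigma>)) t = of_real (exp (- (\<sigma>\<^sup>2 * t\<^sup>2 / 2)))"
proof -
  interpret std: prob_space std_normal_distribution by (rule prob_space_normal_density) simp
  have "distributed std_normal_distribution lborel (\<lambda>x. x) std_normal_density"
    by (simp add: distributed_def distr_id2)
  from std.normal_density_affine[OF this, of \<sigma> 0] assms
  have "distributed std_normal_distribution lborel (\<lambda>x. \<sigma> * x) (normal_density 0 \<sigma>)" by simp
  then have "density lborel (normal_density 0 \<sigma>) = distr std_normal_distribution lborel (\<lambda>x. \<sigma> * x)"
    by (simp add: distributed_distr_eq_density)
  also have "\<dots> = distr std_normal_distribution borel (\<lambda>x. \<sigma> * x)"
    by (rule distr_cong) simp_all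
  finally have "char (density lborel (normal_density 0 \<sigma>)) t = char std_normal_distribution (\<sigma> * t)"
    by (simp add: char_def integral_distr mult_ac)
  then show ?thesis by (simp add: char_std_normal_distribution power_mult_distrib)
qed

text \<open>Up to a constant, the Gaussian on the left is the density of \<open>N(0, 1 / \<sigma>\<^sup>2)\<close>.\<close>

lemma gaussian_fourier_inversion:
  assumes "\<sigma> > 0"
  shows "(CLINT u|lborel. iexp (- (y * u)) * of_real (exp (- (\<sigma>\<^sup>2 * u\<^sup>2 / 2))))
     = of_real (sqrt (2 * pi) / \<sigma> * exp (- (y\<^sup>2 / (2 * \<sigma>\<^sup>2))))"
proof -
  define c where "c = \<sigma> / sqrt (2 * pi)"
  have c: "c > 0" using assms by (simp add: c_def)
  have dens: "normal_density 0 (1 / \<sigma>) u = c * exp (- (\<sigma>\<^sup>2 * u\<^sup>2 / 2))" for u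
    using assms by (simp add: normal_density_def c_def real_sqrt_divide field_simps)
  have "of_real (exp (- (y\<^sup>2 / (2 * \<sigma>\<^sup>2)))) = char (density lborel (normal_density 0 (1 / \<sigma>))) (- y)"
    using assms by (simp add: char_normal power_divide)
  also have "\<dots> = (CLINT u|lborel. normal_density 0 (1 / \<sigma>) u *\<^sub>R iexp (- y * u))"
    unfolding char_def by (subst integral_density) (auto intro!: AE_I2)
  also have "\<dots> = (CLINT u|lborel. of_real c * (iexp (- (y * u)) * of_real (exp (- (\<sigma>\<^sup>2 * u\<^sup>2 / 2)))))"
    by (intro Bochner_Integration.integral_cong refl) (simp add: dens scaleR_conv_of_real mult_ac)
  also have "\<dots> = of_real c * (CLINT u|lborel. iexp (- (y * u)) * of_real (exp (- (\<sigma>\<^sup>2 * u\<^sup>2 / 2))))"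
    by simp
  finally show ?thesis using c assms by (simp add: c_def field_simps)
qed

lemma integrable_gaussian:
  assumes "c > 0"
  shows "integrable lborel (\<lambda>u::real. exp (- (c * u\<^sup>2)))"
proof -
  define \<sigma> where "\<sigma> = 1 / sqrt (2 * c)"
  have \<sigma>: "\<sigma> > 0" using assms by (simp add: \<sigma>_def)
  have "2 * \<sigma>\<^sup>2 = 1 / c" using assms by (simp add: \<sigma>_def power_divide)
  then have "exp (- (c * u\<^sup>2)) = sqrt (2 * pi * \<sigma>\<^sup>2) * normal_density 0 \<sigma> u" for u
    using \<sigma> assms by (simp add: normal_density_def field_simps)
  then show ?thesis using \<sigma> by simp
qed

lemma integral_iexp_period:
  assumes "L > 0"
  shows "(CLINT u|lborel. indicator {- pi * L..pi * L} u *\<^sub>R iexp (of_int k * u / L))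
    = (if k = 0 then of_real (2 * pi * L) else 0)"
proof (cases "k = 0")
  case True
  have "(CLINT u|lborel. indicator {- pi * L..pi * L} u *\<^sub>R (1::complex)) = of_real (pi * L) - of_real (- pi * L)"
    using assms
    by (intro integral_FTC_atLeastAtMost) (auto intro!: derivative_eq_intros simp: has_vector_derivative_def scaleR_conv_of_real)
  then show ?thesis using True by simp
next
  case False
  define d where "d = of_int k / L"
  have d: "d \<noteq> 0" using False assms by (simp add: d_def)
  define G where "G u = iexp (d * u) / (\<i> * of_real d)" for u
  have "(CLINT u|lborel. indicator {- pi * L..pi * L} u *\<^sub>R iexp (d * u)) = G (pi * L) - G (- pi * L)"
  proof (rule integral_FTC_atLeastAtMost)
    show "- pi * L \<le> pi * L" using assms by simp
    show "(G has_vector_derivative iexp (d * x)) (at x within {- pi * L..pi * L})" for x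
      unfolding G_def using d
      by (auto intro!: derivative_eq_intros has_vector_derivative_real_field simp: field_simps)
    show "continuous_on {- pi * L..pi * L} (\<lambda>x. iexp (d * x))" by (intro continuous_intros)
  qed
  moreover have "G (pi * L) = G (- pi * L)"
  proof -
    have "d * (pi * L) = pi * of_int k" "d * (- pi * L) = - (pi * of_int k)" using assms by (auto simp: d_def)
    moreover have "iexp (pi * of_int k) = iexp (- (pi * of_int k))"
      unfolding complex_eq_iff Re_exp Im_exp by (simp add: sin_npi_int)
    ultimately show ?thesis by (simp only: G_def)
  qed
  ultimately show ?thesis using False by (simp add: d_def)
qed

text \<open>Sums of independent Bernoulli variables, row by row, with a centring \<open>m\<close> that differs from the mean by
  \<open>o(s)\<close> and a scale \<open>s\<close> asymptotically proportional to the standard deviation. They are kept flexible because the theorems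
  are needed once with the exact moments and once with their leading terms.\<close>

locale bernoulli_sums =
  fixes N :: "nat \<Rightarrow> nat pmf" and qs :: "nat \<Rightarrow> real list" and m s :: "nat \<Rightarrow> real" and \<sigma> :: real
  assumes qs: "set (qs n) \<subseteq> {0..1}"
    and law: "pmf (N n) k = coeff (bernoulli_prod (qs n)) k"
    and scale_at_top: "filterlim s at_top sequentially"
    and centre: "(\<lambda>n. (sum_list (qs n) - m n) / s n) \<longlonglongrightarrow> 0"
    and scale: "(\<lambda>n. (\<Sum>q\<leftarrow>qs n. q * (1 - q)) / (s n)\<^sup>2) \<longlonglongrightarrow> \<sigma>\<^sup>2"
    and sigma: "\<sigma> > 0"
begin

abbreviation V :: "nat \<Rightarrow> real" where "V n \<equiv> (\<Sum>q\<leftarrow>qs n. q * (1 - q))"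

definition normalised_char :: "nat \<Rightarrow> real \<Rightarrow> complex" where
  "normalised_char n t = iexp (- (m n * (t / s n))) * bernoulli_char (qs n) (t / s n)"

lemma eventually_scale_pos: "\<forall>\<^sub>F n in sequentially. s n > 0"
  using scale_at_top by (simp add: filterlim_at_top_dense)

lemma finite_support: "set_pmf (N n) \<subseteq> {..degree (bernoulli_prod (qs n))}"
  using le_degree[of "bernoulli_prod (qs n)"] by (auto simp: set_pmf_iff law)

lemma bernoulli_char_sum:
  "bernoulli_char (qs n) u = (\<Sum>j\<le>degree (bernoulli_prod (qs n)). of_real (pmf (N n) j) * iexp (real j * u))"
proof -
  let ?F = "bernoulli_prod (qs n)"
  have "bernoulli_char (qs n) u = poly (cpoly ?F) (iexp u)"
    by (simp add: bernoulli_char_def poly_bernoulli_prod)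
  also have "\<dots> = (\<Sum>j\<le>degree ?F. of_real (coeff ?F j) * iexp u ^ j)"
    unfolding poly_altdef by (simp add: degree_map_poly coeff_map_poly)
  also have "\<dots> = (\<Sum>j\<le>degree ?F. of_real (pmf (N n) j) * iexp (real j * u))"
    by (intro sum.cong refl) (simp add: law exp_of_nat_mult[symmetric] mult_ac)
  finally show ?thesis .
qed

lemma char_normalised:
  "char (distr (measure_pmf (N n)) borel (\<lambda>k. (real k - m n) / s n)) t = normalised_char n t"
proof -
  let ?d = "degree (bernoulli_prod (qs n))"
  have "char (distr (measure_pmf (N n)) borel (\<lambda>k. (real k - m n) / s n)) t
     = (CLINT k|measure_pmf (N n). iexp (t * ((real k - m n) / s n)))"
    by (simp add: char_def integral_distr)
  also have "\<dots> = (\<Sum>j\<le>?d. pmf (N n) j *\<^sub>R iexp (t * ((real j - m n) / s n)))"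
    using finite_support by (intro integral_measure_pmf) auto
  also have "\<dots> = (\<Sum>j\<le>?d. iexp (- (m n * (t / s n))) * (of_real (pmf (N n) j) * iexp (real j * (t / s n))))"
  proof (intro sum.cong refl)
    fix j
    have "iexp (t * ((real j - m n) / s n)) = iexp (- (m n * (t / s n))) * iexp (real j * (t / s n))"
      unfolding exp_add[symmetric] by (simp add: diff_divide_distrib algebra_simps)
    then show "pmf (N n) j *\<^sub>R iexp (t * ((real j - m n) / s n))
      = iexp (- (m n * (t / s n))) * (of_real (pmf (N n) j) * iexp (real j * (t / s n)))"
      by (simp only: scaleR_conv_of_real mult_ac)
  qed
  finally show ?thesis by (simp only: normalised_char_def bernoulli_char_sum sum_distrib_left)
qed

lemma normalised_char_tendsto:
  "(\<lambda>n. normalised_char n t) \<longlonglongrightarrow> of_real (exp (- (\<sigma>\<^sup>2 * t\<^sup>2 / 2)))"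
proof -
  define A where "A n = iexp (- (sum_list (qs n) * (t / s n))) * bernoulli_char (qs n) (t / s n)" for n
  define B where "B n = complex_of_real (exp (- (V n / (s n)\<^sup>2 * t\<^sup>2 / 2)))" for n
  define R where "R n = V n / (s n)\<^sup>2 * (\<bar>t\<bar> ^ 3 * inverse (s n) + t ^ 4 * (inverse (s n))\<^sup>2)" for n
  have inv: "(\<lambda>n. inverse (s n)) \<longlonglongrightarrow> 0"
    by (rule tendsto_inverse_0_at_top[OF scale_at_top])
  have "R \<longlonglongrightarrow> \<sigma>\<^sup>2 * (\<bar>t\<bar> ^ 3 * 0 + t ^ 4 * 0\<^sup>2)"
    unfolding R_def by (intro tendsto_intros scale inv)
  then have R: "R \<longlonglongrightarrow> 0" by simp
  have AB: "(\<lambda>n. A n - B n) \<longlonglongrightarrow> 0"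
  proof (rule Lim_null_comparison[OF _ R])
    show "\<forall>\<^sub>F n in sequentially. norm (A n - B n) \<le> R n"
      using eventually_scale_pos
    proof eventually_elim
      case (elim n)
      have "V n * (\<bar>t / s n\<bar> ^ 3 + (t / s n) ^ 4) = R n"
        using elim by (simp add: R_def power_divide field_simps eval_nat_numeral)
      then show ?case
        using centred_bernoulli_char[OF qs, of n "t / s n"]
        by (simp add: A_def B_def power_divide)
    qed
  qed
  have B: "B \<longlonglongrightarrow> of_real (exp (- (\<sigma>\<^sup>2 * t\<^sup>2 / 2)))"
    unfolding B_def by (intro tendsto_intros scale) auto
  have A: "A \<longlonglongrightarrow> of_real (exp (- (\<sigma>\<^sup>2 * t\<^sup>2 / 2)))"
    using tendsto_add[OF AB B] by simp
  \<comment> \<open>replacing the exact mean by \<open>m\<close> costs a factor that tends to \<open>1\<close>\<close>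
  have "(\<lambda>n. iexp (t * ((sum_list (qs n) - m n) / s n))) \<longlonglongrightarrow> iexp (t * 0)"
    by (intro tendsto_intros centre)
  from tendsto_mult[OF this A]
  have "(\<lambda>n. iexp (t * ((sum_list (qs n) - m n) / s n)) * A n) \<longlonglongrightarrow> of_real (exp (- (\<sigma>\<^sup>2 * t\<^sup>2 / 2)))"
    by simp
  moreover have "iexp (t * ((sum_list (qs n) - m n) / s n)) * A n = normalised_char n t" for n
  proof -
    have "iexp (t * ((sum_list (qs n) - m n) / s n)) * iexp (- (sum_list (qs n) * (t / s n))) = iexp (- (m n * (t / s n)))"
      unfolding exp_add[symmetric] by (simp add: diff_divide_distrib algebra_simps)
    then show ?thesis by (simp only: A_def normalised_char_def mult.assoc[symmetric])
  qed
  ultimately show ?thesis by simp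
qed

theorem central_limit:
  "weak_conv_m (\<lambda>n. distr (measure_pmf (N n)) borel (\<lambda>k. (real k - m n) / s n))
     (density lborel (normal_density 0 \<sigma>))"
proof (rule levy_continuity)
  show "real_distribution (distr (measure_pmf (N n)) borel (\<lambda>k. (real k - m n) / s n))" for n
    by (rule prob_space.real_distribution_distr[OF prob_space_measure_pmf]) simp
  show "real_distribution (density lborel (normal_density 0 \<sigma>))"
    using prob_space_normal_density[OF sigma] by (simp add: real_distribution_def real_distribution_axioms_def)
  show "(\<lambda>n. char (distr (measure_pmf (N n)) borel (\<lambda>k. (real k - m n) / s n)) t)
      \<longlonglongrightarrow> char (density lborel (normal_density 0 \<sigma>)) t" for t
    unfolding char_normalised char_normal[OF sigma] by (rule normalised_char_tendsto)
qed

text \<open>Fourier inversion on the lattice, rescaled so that the integrand is the characteristic function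
  of the normalised variable.\<close>

lemma point_prob_fourier:
  assumes s: "s n > 0"
  shows "of_real (2 * pi * s n * measure_pmf.prob (N n) {j. int j = k})
    = (CLINT u|lborel. indicator {- pi * s n..pi * s n} u *\<^sub>R (iexp (- ((of_int k - m n) / s n * u)) * normalised_char n u))"
proof -
  let ?d = "degree (bernoulli_prod (qs n))" and ?I = "{- pi * s n..pi * s n}"
  have eq: "indicator ?I u *\<^sub>R (iexp (- ((of_int k - m n) / s n * u)) * normalised_char n u)
     = (\<Sum>j\<le>?d. of_real (pmf (N n) j) * (indicator ?I u *\<^sub>R iexp (of_int (int j - k) * u / s n)))" for u
  proof -
    have "iexp (- ((of_int k - m n) / s n * u)) * iexp (- (m n * (u / s n))) * iexp (real j * (u / s n))
        = iexp (of_int (int j - k) * u / s n)" for j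
      unfolding exp_add[symmetric] by (simp add: diff_divide_distrib algebra_simps)
    then have "iexp (- ((of_int k - m n) / s n * u)) * (iexp (- (m n * (u / s n))) * (of_real (pmf (N n) j) * iexp (real j * (u / s n))))
       = of_real (pmf (N n) j) * iexp (of_int (int j - k) * u / s n)" for j
      by (metis (no_types, lifting) mult.assoc mult.left_commute)
    then have "iexp (- ((of_int k - m n) / s n * u)) * normalised_char n u
       = (\<Sum>j\<le>?d. of_real (pmf (N n) j) * iexp (of_int (int j - k) * u / s n))"
      unfolding normalised_char_def bernoulli_char_sum sum_distrib_left by (intro sum.cong refl)
    then show ?thesis by (simp only: scaleR_sum_right mult_scaleR_right)
  qed
  have int: "integrable lborel (\<lambda>u. indicator ?I u *\<^sub>R iexp (of_int (int j - k) * u / s n))" for j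
    by (intro borel_integrable_compact continuous_intros) (use s in auto)
  have "(CLINT u|lborel. indicator ?I u *\<^sub>R (iexp (- ((of_int k - m n) / s n * u)) * normalised_char n u))
    = (\<Sum>j\<le>?d. CLINT u|lborel. of_real (pmf (N n) j) * (indicator ?I u *\<^sub>R iexp (of_int (int j - k) * u / s n)))"
    unfolding eq by (rule Bochner_Integration.integral_sum) (rule integrable_mult_right[OF int])
  also have "\<dots> = (\<Sum>j\<le>?d. of_real (pmf (N n) j) * (if int j - k = 0 then of_real (2 * pi * s n) else 0))"
    by (simp only: integral_mult_right_zero integral_iexp_period[OF s])
  also have "\<dots> = of_real (2 * pi * s n * (\<Sum>j\<le>?d. indicator {j. int j = k} j * pmf (N n) j))"
    unfolding of_real_mult[of "2 * pi * s n"] of_real_sum sum_distrib_left by (intro sum.cong refl) (auto simp: indicator_def)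
  also have "(\<Sum>j\<le>?d. indicator {j. int j = k} j * pmf (N n) j) = measure_pmf.prob (N n) {j. int j = k}"
  proof -
    have "measure_pmf.prob (N n) {j. int j = k} = (LINT j|measure_pmf (N n). indicator {j. int j = k} j)" by simp
    also have "\<dots> = (\<Sum>j\<le>?d. indicator {j. int j = k} j * pmf (N n) j)"
      using finite_support by (intro integral_measure_pmf_real) auto
    finally show ?thesis by simp
  qed
  finally show ?thesis by simp
qed

lemma continuous_normalised_char: "continuous_on A (normalised_char n)"
  unfolding normalised_char_def bernoulli_char_sum divide_inverse by (intro continuous_intros)

lemma norm_normalised_char_le:
  assumes s: "s n > 0" and V: "V n / (s n)\<^sup>2 \<ge> \<sigma>\<^sup>2 / 2" and u: "\<bar>u\<bar> \<le> pi * s n"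
  shows "cmod (normalised_char n u) \<le> exp (- (\<sigma>\<^sup>2 / 24 * u\<^sup>2))"
proof -
  have "0 \<le> x \<and> x \<le> 1" if "x \<in> set (qs n)" for x using subsetD[OF qs that] by simp
  then have V0: "V n \<ge> 0" by (intro sum_list_nonneg) auto
  have "\<bar>u / s n\<bar> \<le> pi" using s u unfolding abs_divide by (simp add: pos_divide_le_eq)
  then have cos: "(u / s n)\<^sup>2 / 12 \<le> 1 - cos (u / s n)" by (rule one_minus_cos_ge)
  have "\<sigma>\<^sup>2 / 24 * u\<^sup>2 = \<sigma>\<^sup>2 / 2 * (u\<^sup>2 / 12)" by simp
  also have "\<dots> \<le> V n / (s n)\<^sup>2 * (u\<^sup>2 / 12)" by (intro mult_right_mono V) simp
  also have "\<dots> = V n * ((u / s n)\<^sup>2 / 12)" by (simp add: power_divide)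
  also have "\<dots> \<le> V n * (1 - cos (u / s n))" by (intro mult_left_mono cos V0)
  finally have "exp (- (V n * (1 - cos (u / s n)))) \<le> exp (- (\<sigma>\<^sup>2 / 24 * u\<^sup>2))" by simp
  moreover have "cmod (normalised_char n u) = cmod (bernoulli_char (qs n) (u / s n))"
    unfolding normalised_char_def norm_mult norm_exp_i_times by simp
  ultimately show ?thesis using norm_bernoulli_char_le[OF qs, of n "u / s n"] by linarith
qed

text \<open>The integrand of the Fourier inversion formula without its oscillating factor, truncated to one
  period, minus its Gaussian limit.\<close>

definition char_error :: "nat \<Rightarrow> real \<Rightarrow> complex" where
  "char_error n u = indicator {- pi * s n..pi * s n} u *\<^sub>R normalised_char n u - of_real (exp (- (\<sigma>\<^sup>2 * u\<^sup>2 / 2)))"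

lemma integrable_truncated_char:
  "integrable lborel (\<lambda>u. indicator {- pi * s n..pi * s n} u *\<^sub>R (iexp (y * u) * normalised_char n u))"
  by (intro borel_integrable_compact continuous_intros continuous_normalised_char) auto

lemma integrable_gaussian_iexp:
  "integrable lborel (\<lambda>u. iexp (y * u) * of_real (exp (- (\<sigma>\<^sup>2 * u\<^sup>2 / 2))))"
proof (rule Bochner_Integration.integrable_bound)
  show "integrable lborel (\<lambda>u::real. exp (- (\<sigma>\<^sup>2 / 2 * u\<^sup>2)))"
    using sigma by (intro integrable_gaussian) simp
qed (auto simp: norm_mult)

lemma char_error_measurable: "char_error n \<in> borel_measurable lborel"
proof -
  have "(\<lambda>u. indicator {- pi * s n..pi * s n} u *\<^sub>R normalised_char n u) \<in> borel_measurable lborel"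
    using borel_measurable_integrable[OF integrable_truncated_char[of n 0]] by simp
  moreover have "(\<lambda>u. complex_of_real (exp (- (\<sigma>\<^sup>2 * u\<^sup>2 / 2)))) \<in> borel_measurable lborel" by measurable
  ultimately show ?thesis unfolding char_error_def by (rule borel_measurable_diff)
qed

text \<open>The bound on the modulus of the characteristic function provides a Gaussian dominating function
  that does not depend on \<open>n\<close>.\<close>

lemma integral_char_error_tendsto: "(\<lambda>n. LINT u|lborel. cmod (char_error n u)) \<longlonglongrightarrow> 0"
proof -
  define w where "w u = exp (- (\<sigma>\<^sup>2 / 24 * u\<^sup>2)) + exp (- (\<sigma>\<^sup>2 / 2 * u\<^sup>2))" for u :: real
  have "\<sigma>\<^sup>2 / 2 < \<sigma>\<^sup>2" using sigma by simp
  then have "\<forall>\<^sub>F n in sequentially. \<sigma>\<^sup>2 / 2 < V n / (s n)\<^sup>2" by (rule order_tendstoD(1)[OF scale])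
  with eventually_scale_pos have "\<forall>\<^sub>F n in sequentially. s n > 0 \<and> \<sigma>\<^sup>2 / 2 < V n / (s n)\<^sup>2"
    by (rule eventually_conj)
  \<comment> \<open>dominated convergence needs the bound for all indices, so the sequence starts at \<open>n0\<close>\<close>
  then obtain n0 where n0: "s n > 0" "\<sigma>\<^sup>2 / 2 < V n / (s n)\<^sup>2" if "n \<ge> n0" for n
    unfolding eventually_sequentially by blast
  have "(\<lambda>n. LINT u|lborel. cmod (char_error (n + n0) u)) \<longlonglongrightarrow> (LINT u|(lborel :: real measure). (0::real))"
  proof (rule integral_dominated_convergence)
    show "integrable lborel w"
      unfolding w_def using sigma by (intro Bochner_Integration.integrable_add integrable_gaussian) auto
    show "(\<lambda>u. cmod (char_error (n + n0) u)) \<in> borel_measurable lborel" for n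
      by (rule measurable_compose[OF char_error_measurable borel_measurable_norm])
    show "AE u in lborel. norm (cmod (char_error (n + n0) u)) \<le> w u" for n
    proof (rule AE_I2)
      fix u :: real
      let ?n = "n + n0"
      have "cmod (indicator {- pi * s ?n..pi * s ?n} u *\<^sub>R normalised_char ?n u) \<le> exp (- (\<sigma>\<^sup>2 / 24 * u\<^sup>2))"
      proof (cases "\<bar>u\<bar> \<le> pi * s ?n")
        case True
        then show ?thesis
          using norm_normalised_char_le[of ?n u] n0[of ?n] by (simp add: indicator_def)
      next
        case False
        have "u \<notin> {- pi * s ?n..pi * s ?n}" using False by auto
        then show ?thesis by simp
      qed
      moreover have "cmod (char_error ?n u) \<le> cmod (indicator {- pi * s ?n..pi * s ?n} u *\<^sub>R normalised_char ?n u)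
          + cmod (of_real (exp (- (\<sigma>\<^sup>2 * u\<^sup>2 / 2))))"
        unfolding char_error_def by (rule norm_triangle_ineq4)
      ultimately show "norm (cmod (char_error ?n u)) \<le> w u" by (simp add: w_def)
    qed
    show "AE u in lborel. (\<lambda>n. cmod (char_error (n + n0) u)) \<longlonglongrightarrow> 0"
    proof (rule AE_I2)
      fix u :: real
      have "\<forall>\<^sub>F n in sequentially. s n \<ge> \<bar>u\<bar> / pi"
        using scale_at_top by (simp add: filterlim_at_top)
      then have "\<forall>\<^sub>F n in sequentially. normalised_char n u - of_real (exp (- (\<sigma>\<^sup>2 * u\<^sup>2 / 2))) = char_error n u"
      proof eventually_elim
        case (elim n)
        then have "\<bar>u\<bar> \<le> pi * s n" by (simp add: pos_divide_le_eq mult.commute)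
        then have "u \<in> {- pi * s n..pi * s n}" by auto
        then show ?case by (simp add: char_error_def)
      qed
      moreover have "(\<lambda>n. normalised_char n u - of_real (exp (- (\<sigma>\<^sup>2 * u\<^sup>2 / 2)))) \<longlonglongrightarrow> 0"
        using normalised_char_tendsto[of u] by (simp add: LIM_zero)
      ultimately have "(\<lambda>n. char_error n u) \<longlonglongrightarrow> 0" by (rule Lim_transform_eventually[rotated])
      then have "(\<lambda>n. cmod (char_error n u)) \<longlonglongrightarrow> 0" by (rule tendsto_norm_zero)
      then show "(\<lambda>n. cmod (char_error (n + n0) u)) \<longlonglongrightarrow> 0" by (rule LIMSEQ_ignore_initial_segment)
    qed
  qed simp
  then show ?thesis by (simp add: LIMSEQ_offset)
qed

text \<open>The point probability and the Gaussian are both Fourier integrals against \<open>exp (- i y u)\<close>, which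
  has modulus \<open>1\<close>; this is why the bound is uniform in \<open>k\<close>.\<close>

lemma local_limit_error_le:
  assumes s: "s n > 0"
  shows "\<bar>sqrt (2 * pi) * \<sigma> * s n * measure_pmf.prob (N n) {j. int j = k}
      - exp (- ((of_int k - m n)\<^sup>2 / (2 * \<sigma>\<^sup>2 * (s n)\<^sup>2)))\<bar>
    \<le> \<sigma> / sqrt (2 * pi) * (LINT u|lborel. cmod (char_error n u))"
proof -
  define y where "y = (of_int k - m n) / s n"
  define P where "P = measure_pmf.prob (N n) {j. int j = k}"
  define c where "c = \<sigma> / sqrt (2 * pi)"
  have c: "c > 0" using sigma by (simp add: c_def)
  have e1: "sqrt (2 * pi) * \<sigma> * s n * P = c * (2 * pi * s n * P)"
    using sigma by (simp add: c_def field_simps real_sqrt_mult)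
  have e2: "exp (- ((of_int k - m n)\<^sup>2 / (2 * \<sigma>\<^sup>2 * (s n)\<^sup>2))) = c * (sqrt (2 * pi) / \<sigma> * exp (- (y\<^sup>2 / (2 * \<sigma>\<^sup>2))))"
    using sigma by (simp add: c_def y_def power_divide field_simps)
  have split: "iexp (- (y * u)) * char_error n u
     = indicator {- pi * s n..pi * s n} u *\<^sub>R (iexp (- (y * u)) * normalised_char n u)
       - iexp (- (y * u)) * of_real (exp (- (\<sigma>\<^sup>2 * u\<^sup>2 / 2)))" for u
    by (simp add: char_error_def right_diff_distrib)
  have "of_real (sqrt (2 * pi) * \<sigma> * s n * P - exp (- ((of_int k - m n)\<^sup>2 / (2 * \<sigma>\<^sup>2 * (s n)\<^sup>2))))
     = of_real c * (of_real (2 * pi * s n * P) - of_real (sqrt (2 * pi) / \<sigma> * exp (- (y\<^sup>2 / (2 * \<sigma>\<^sup>2)))))"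
    unfolding e1 e2 by (simp only: of_real_mult of_real_diff right_diff_distrib)
  also have "of_real (2 * pi * s n * P) - of_real (sqrt (2 * pi) / \<sigma> * exp (- (y\<^sup>2 / (2 * \<sigma>\<^sup>2))))
     = (CLINT u|lborel. iexp (- (y * u)) * char_error n u)"
    unfolding P_def point_prob_fourier[OF s] gaussian_fourier_inversion[OF sigma, symmetric] split y_def[symmetric]
    using Bochner_Integration.integral_diff[OF integrable_truncated_char[of n "- y"] integrable_gaussian_iexp[of "- y"]]
    by (simp only: mult_minus_left)
  finally have eq: "complex_of_real (sqrt (2 * pi) * \<sigma> * s n * P - exp (- ((of_int k - m n)\<^sup>2 / (2 * \<sigma>\<^sup>2 * (s n)\<^sup>2))))
     = of_real c * (CLINT u|lborel. iexp (- (y * u)) * char_error n u)" .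
  have "\<bar>sqrt (2 * pi) * \<sigma> * s n * P - exp (- ((of_int k - m n)\<^sup>2 / (2 * \<sigma>\<^sup>2 * (s n)\<^sup>2)))\<bar>
     = c * cmod (CLINT u|lborel. iexp (- (y * u)) * char_error n u)"
    using arg_cong[OF eq, of cmod] by (simp only: norm_mult norm_of_real abs_of_pos[OF c])
  also have "\<dots> \<le> c * (LINT u|lborel. cmod (iexp (- (y * u)) * char_error n u))"
    using c by (intro mult_left_mono integral_norm_bound) auto
  also have "(LINT u|lborel. cmod (iexp (- (y * u)) * char_error n u)) = (LINT u|lborel. cmod (char_error n u))"
    unfolding norm_mult norm_exp_i_times by simp
  finally show ?thesis by (simp only: P_def c_def)
qed

theorem local_limit:
  "uniform_limit UNIV (\<lambda>n k. sqrt (2 * pi) * \<sigma> * s n * measure_pmf.prob (N n) {j. int j = k}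
      - exp (- ((of_int k - m n)\<^sup>2 / (2 * \<sigma>\<^sup>2 * (s n)\<^sup>2)))) (\<lambda>_. 0) sequentially"
proof (rule uniform_limitI)
  fix e :: real
  assume e: "e > 0"
  have "(\<lambda>n. \<sigma> / sqrt (2 * pi) * (LINT u|lborel. cmod (char_error n u))) \<longlonglongrightarrow> \<sigma> / sqrt (2 * pi) * 0"
    by (intro tendsto_intros integral_char_error_tendsto)
  then have "\<forall>\<^sub>F n in sequentially. \<sigma> / sqrt (2 * pi) * (LINT u|lborel. cmod (char_error n u)) < e"
    using e by (intro order_tendstoD(2)) auto
  with eventually_scale_pos
  show "\<forall>\<^sub>F n in sequentially. \<forall>k\<in>UNIV. dist (sqrt (2 * pi) * \<sigma> * s n * measure_pmf.prob (N n) {j. int j = k}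
      - exp (- ((of_int k - m n)\<^sup>2 / (2 * \<sigma>\<^sup>2 * (s n)\<^sup>2)))) 0 < e"
  proof eventually_elim
    case (elim n)
    show ?case
      unfolding dist_real_def diff_0_right
      using le_less_trans[OF local_limit_error_le[OF elim(1)] elim(2)] by blast
  qed
qed

end

section \<open>Asymptotic normality for staircase tableaux\<close>

lemma powr_neg_half:
  fixes x :: real
  assumes "x > 0"
  shows "x powr (- 1 / 2) = 1 / sqrt x"
proof -
  have "x powr (- 1 / 2) = x powr (- (1 / 2))" by (rule arg_cong) simp
  also have "\<dots> = inverse (x powr (1 / 2))" by (rule powr_minus)
  also have "\<dots> = inverse (sqrt x)" using assms by (simp only: powr_half_sqrt less_imp_le)
  finally show ?thesis by (simp only: inverse_eq_divide)
qed

text \<open>Turns the rescaled difference that the local limit theorem controls into the error term of the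
  asymptotic formula.\<close>

lemma recover_from_error:
  fixes D P E :: real
  assumes "D \<noteq> 0"
  shows "P = 1 / D * (E + (D * P - E))"
proof -
  have "E + (D * P - E) = D * P" by linarith
  then show ?thesis using assms by simp
qed

theorem theorem1p11:
  fixes \<alpha> \<beta> :: ennreal
  assumes "0 < \<alpha>" and "0 < \<beta>"
  shows "(weak_conv_m
           (\<lambda>n. distr (measure_pmf (random_tableau n \<alpha> \<beta>)) borel
                  (\<lambda>S. (real (diag_alphas n S) - mean_A n \<alpha> \<beta>) / sqrt (var_A n \<alpha> \<beta>)))
           (density lborel (normal_density 0 1)))
    \<and> (weak_conv_m
           (\<lambda>n. distr (measure_pmf (random_tableau n \<alpha> \<beta>)) borel
                  (\<lambda>S. (real (diag_alphas n S) - real n / 2) / sqrt (real n)))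
           (density lborel (normal_density 0 (sqrt (1 / 12)))))
    \<and> (\<exists>\<epsilon> :: nat \<Rightarrow> int \<Rightarrow> real.
           uniform_limit UNIV \<epsilon> (\<lambda>_. 0) sequentially \<and>
           (\<forall>\<^sub>F n in sequentially. \<forall>k.
              prob_A n \<alpha> \<beta> k =
                (2 * pi * var_A n \<alpha> \<beta>) powr (- 1 / 2) *
                (exp (- ((of_int k - mean_A n \<alpha> \<beta>)\<^sup>2 / (2 * var_A n \<alpha> \<beta>))) + \<epsilon> n k)))
    \<and> (\<exists>\<epsilon> :: nat \<Rightarrow> int \<Rightarrow> real.
           uniform_limit UNIV \<epsilon> (\<lambda>_. 0) sequentially \<and>
           (\<forall>\<^sub>F n in sequentially. \<forall>k.
              prob_A n \<alpha> \<beta> k =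
                sqrt (6 / (pi * real n)) *
                (exp (- 6 * (of_int k - real n / 2)\<^sup>2 / real n) + \<epsilon> n k)))"
proof -
  obtain a b p where ab: "a \<ge> 0" "b \<ge> 0" and p: "0 \<le> p" "p \<le> 1" and abp: "(a + b) * p = b"
    and law: "\<And>n. (\<Sum>S\<in>staircase_tableaux n. monom (tableau_prob n \<alpha> \<beta> S) (diag_alphas n S)) = diag_poly a b p n"
    using tableau_prob_poly[OF assms] by blast
  define N where "N n = map_pmf (diag_alphas n) (random_tableau n \<alpha> \<beta>)" for n
  define \<mu> where "\<mu> n = mean_A n \<alpha> \<beta>" for n
  define W where "W n = var_A n \<alpha> \<beta>" for n
  obtain qs where qs: "set (qs n) \<subseteq> {0..1}" "diag_poly a b p n = bernoulli_prod (qs n)" for n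
    using diag_poly_bernoulli_prod[OF ab p] by metis
  have pmfN: "pmf (N n) k = coeff (bernoulli_prod (qs n)) k" for n k
    unfolding N_def qs(2)[symmetric] by (rule pmf_diag_alphas[OF assms law])
  have mu: "\<mu> n = mean_value a b p n" for n
    unfolding \<mu>_def mean_value_def by (rule mean_var_A_eq(1)[OF assms law])
  have var: "W n = var_value a b p n" for n
    unfolding W_def var_value_def mean_value_def by (rule mean_var_A_eq(2)[OF assms law])
  have mu_sum: "sum_list (qs n) = \<mu> n" for n
    unfolding mu mean_value_def qs(2) by (rule bernoulli_prod_moments(2)[symmetric])
  have var_sum: "(\<Sum>q\<leftarrow>qs n. q * (1 - q)) = W n" for n
    using bernoulli_prod_moments(3)[of "qs n"]
    unfolding var var_value_def mean_value_def qs(2) bernoulli_prod_moments(2) by simp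
  have lim_mu: "(\<lambda>n. (\<mu> n - real n / 2) / sqrt (real n)) \<longlonglongrightarrow> 0"
    unfolding mu by (rule mean_value_asymp[OF ab abp])
  have lim_var: "(\<lambda>n. W n / real n) \<longlonglongrightarrow> 1 / 12"
    unfolding var by (rule var_value_asymp[OF ab abp])
  have W_top: "filterlim W at_top sequentially"
  proof (rule filterlim_at_top_mono)
    show "filterlim (\<lambda>n. 1 / 24 * real n) at_top sequentially" by real_asymp
    have "\<forall>\<^sub>F n in sequentially. 1 / 24 < W n / real n" by (rule order_tendstoD(1)[OF lim_var]) simp
    then show "\<forall>\<^sub>F n in sequentially. 1 / 24 * real n \<le> W n"
      using eventually_gt_at_top[of 0] by eventually_elim (simp add: field_simps)
  qed
  have W_pos: "\<forall>\<^sub>F n in sequentially. W n > 0" using W_top by (simp add: filterlim_at_top_dense)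
  have probA: "prob_A n \<alpha> \<beta> k = measure_pmf.prob (N n) {j. int j = k}" for n k
    by (simp add: prob_A_def N_def vimage_def)
  have distrN: "distr (measure_pmf (N n)) borel f = distr (measure_pmf (random_tableau n \<alpha> \<beta>)) borel (\<lambda>S. f (diag_alphas n S))"
    for n and f :: "nat \<Rightarrow> real"
    unfolding N_def map_pmf_rep_eq by (simp add: distr_distr comp_def)

  \<comment> \<open>exact mean and standard deviation, with limiting variance \<open>1\<close>\<close>
  interpret std: bernoulli_sums N qs \<mu> "\<lambda>n. sqrt (W n)" 1
  proof
    show "filterlim (\<lambda>n. sqrt (W n)) at_top sequentially"
      by (rule filterlim_compose[OF sqrt_at_top W_top])
    have "\<forall>\<^sub>F n in sequentially. 1\<^sup>2 = (\<Sum>q\<leftarrow>qs n. q * (1 - q)) / (sqrt (W n))\<^sup>2"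
      using W_pos by eventually_elim (simp add: var_sum)
    then show "(\<lambda>n. (\<Sum>q\<leftarrow>qs n. q * (1 - q)) / (sqrt (W n))\<^sup>2) \<longlonglongrightarrow> 1\<^sup>2"
      by (rule Lim_transform_eventually[OF tendsto_const])
  qed (simp_all add: qs pmfN mu_sum)
  \<comment> \<open>leading terms of mean and standard deviation, with limiting variance \<open>1 / 12\<close>\<close>
  interpret explicit: bernoulli_sums N qs "\<lambda>n. real n / 2" "\<lambda>n. sqrt (real n)" "sqrt (1 / 12)"
  proof
    show "filterlim (\<lambda>n. sqrt (real n)) at_top sequentially" by real_asymp
    show "(\<lambda>n. (sum_list (qs n) - real n / 2) / sqrt (real n)) \<longlonglongrightarrow> 0"
      unfolding mu_sum by (rule lim_mu)
    show "(\<lambda>n. (\<Sum>q\<leftarrow>qs n. q * (1 - q)) / (sqrt (real n))\<^sup>2) \<longlonglongrightarrow> (sqrt (1 / 12))\<^sup>2"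
      unfolding var_sum using lim_var by simp
  qed (simp_all add: qs pmfN)

  have "\<exists>\<epsilon> :: nat \<Rightarrow> int \<Rightarrow> real. uniform_limit UNIV \<epsilon> (\<lambda>_. 0) sequentially \<and>
     (\<forall>\<^sub>F n in sequentially. \<forall>k. prob_A n \<alpha> \<beta> k = (2 * pi * W n) powr (- 1 / 2) *
        (exp (- ((of_int k - \<mu> n)\<^sup>2 / (2 * W n))) + \<epsilon> n k))"
  proof (intro exI conjI)
    show "uniform_limit UNIV (\<lambda>n k. sqrt (2 * pi) * 1 * sqrt (W n) * measure_pmf.prob (N n) {j. int j = k}
      - exp (- ((of_int k - \<mu> n)\<^sup>2 / (2 * 1\<^sup>2 * (sqrt (W n))\<^sup>2)))) (\<lambda>_. 0) sequentially"
      by (rule std.local_limit)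
    show "\<forall>\<^sub>F n in sequentially. \<forall>k. prob_A n \<alpha> \<beta> k = (2 * pi * W n) powr (- 1 / 2) *
        (exp (- ((of_int k - \<mu> n)\<^sup>2 / (2 * W n)))
         + (sqrt (2 * pi) * 1 * sqrt (W n) * measure_pmf.prob (N n) {j. int j = k}
            - exp (- ((of_int k - \<mu> n)\<^sup>2 / (2 * 1\<^sup>2 * (sqrt (W n))\<^sup>2)))))"
      using W_pos
    proof eventually_elim
      case (elim n)
      have D: "(2 * pi * W n) powr (- 1 / 2) = 1 / (sqrt (2 * pi) * 1 * sqrt (W n))"
        using elim powr_neg_half[of "2 * pi * W n"] by (simp only: real_sqrt_mult mult_1_right) simp
      have E: "2 * 1\<^sup>2 * (sqrt (W n))\<^sup>2 = 2 * W n" using elim by simp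
      show ?case
        unfolding D E probA using elim by (intro allI recover_from_error) simp
    qed
  qed
  moreover have "\<exists>\<epsilon> :: nat \<Rightarrow> int \<Rightarrow> real. uniform_limit UNIV \<epsilon> (\<lambda>_. 0) sequentially \<and>
     (\<forall>\<^sub>F n in sequentially. \<forall>k. prob_A n \<alpha> \<beta> k = sqrt (6 / (pi * real n)) *
        (exp (- 6 * (of_int k - real n / 2)\<^sup>2 / real n) + \<epsilon> n k))"
  proof (intro exI conjI)
    show "uniform_limit UNIV (\<lambda>n k. sqrt (2 * pi) * sqrt (1 / 12) * sqrt (real n) * measure_pmf.prob (N n) {j. int j = k}
      - exp (- ((of_int k - real n / 2)\<^sup>2 / (2 * (sqrt (1 / 12))\<^sup>2 * (sqrt (real n))\<^sup>2)))) (\<lambda>_. 0) sequentially"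
      by (rule explicit.local_limit)
    show "\<forall>\<^sub>F n in sequentially. \<forall>k. prob_A n \<alpha> \<beta> k = sqrt (6 / (pi * real n)) *
        (exp (- 6 * (of_int k - real n / 2)\<^sup>2 / real n)
         + (sqrt (2 * pi) * sqrt (1 / 12) * sqrt (real n) * measure_pmf.prob (N n) {j. int j = k}
            - exp (- ((of_int k - real n / 2)\<^sup>2 / (2 * (sqrt (1 / 12))\<^sup>2 * (sqrt (real n))\<^sup>2)))))"
      using eventually_gt_at_top[of 0]
    proof eventually_elim
      case (elim n)
      have "sqrt (6 / (pi * real n)) * (sqrt (2 * pi) * sqrt (1 / 12) * sqrt (real n))
          = sqrt (6 / (pi * real n) * (2 * pi * (1 / 12) * real n))"
        unfolding real_sqrt_mult ..
      also have "6 / (pi * real n) * (2 * pi * (1 / 12) * real n) = 1" using elim by simp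
      finally have D: "sqrt (6 / (pi * real n)) = 1 / (sqrt (2 * pi) * sqrt (1 / 12) * sqrt (real n))"
        by (simp only: real_sqrt_one) (rule eq_divide_imp, use elim in simp_all)
      have E: "- ((of_int k - real n / 2)\<^sup>2 / (2 * (sqrt (1 / 12))\<^sup>2 * (sqrt (real n))\<^sup>2))
          = - 6 * (of_int k - real n / 2)\<^sup>2 / real n" for k
        by simp
      show ?case
        unfolding D E probA using elim by (intro allI recover_from_error) simp
    qed
  qed
  ultimately show ?thesis
    using std.central_limit explicit.central_limit unfolding distrN \<mu>_def W_def by blast
qed

end
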